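(* Let $q=p^e$ be a power of a prime $p$, let $d\geq 2$ be an even integer with $q\equiv 1 \pmod{2d(d-1)}$, and let $a,b\in\mathbb{F}_q^\times$. Let $N'_d=\#\{(x,y)\in\mathbb{F}_q^2 : y^2=x^d+ax^{d-1}+b\}$. Let $T$ be a generator of $\widehat{\mathbb{F}_q^\times}$ and put $\chi=T^{\frac{q-1}{d}}$ (order $d$) and $\psi=T^{\frac{q-1}{2(d-1)}}$ (order $2(d-1)$). Then $$N'_d=q+\phi(b)+q^{\frac d2}\,\phi(d-1)\;{}_{d}F_{d-1}\!\left(\begin{array}{c}A_0,A_1,\ldots,A_{d-1}\\ B_1,\ldots,B_{d-1}\end{array}\Big|\ \beta\right),$$ where $\beta=\dfrac{bd^d}{a^d(d-1)^{d-1}}$, $A_0=\phi$, $A_1=\varepsilon$, $B_1=\phi$, and the remaining $d-2$ pairs $(A_i,B_i)$, $i=2,\ldots,d-1$, are the pairs $(\chi^j,\psi^{2j-1})$ for $j\in\{1,\ldots,d-1\}\setminus\{d/2\}$ in increasing order of $j$; i.e. the top row is $\phi,\varepsilon,\chi,\chi^2,\ldots,\chi^{\frac{d-2}{2}},\chi^{\frac{d+2}{2}},\ldots,\chi^{d-1}$ and the bottom row is $\phi,\psi,\psi^3,\ldots,\psi^{d-3},\psi^{d+1},\ldots,\psi^{2d-3}$.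
   Context: $\widehat{\mathbb{F}_q^\times}$ denotes the group of multiplicative characters of $\mathbb{F}_q^\times$; every character (including the trivial one) is extended to $\mathbb{F}_q$ by setting $\chi(0)=0$. $\varepsilon$ is the trivial character and $\phi$ the quadratic character. For characters $A,B$, $\overline{B}$ is the inverse of $B$ and $${A\choose B}:=\frac{B(-1)}{q}\sum_{x\in\mathbb{F}_q}A(x)\overline{B}(1-x).$$ For characters $A_0,\ldots,A_n,B_1,\ldots,B_n$ and $x\in\mathbb{F}_q$, the Gaussian hypergeometric series is $${}_{n+1}F_n\!\left(\begin{array}{c}A_0,A_1,\ldots,A_n\\ B_1,\ldots,B_n\end{array}\Big|\ x\right):=\frac{q}{q-1}\sum_{\chi}{A_0\chi\choose\chi}{A_1\chi\choose B_1\chi}\cdots{A_n\chi\choose B_n\chi}\chi(x),$$ the sum over all multiplicative characters $\chi$ of $\mathbb{F}_q$. *)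

theory Defs
  imports Complex_Main "HOL-Computational_Algebra.Primes" "HOL-Number_Theory.Cong"
begin

definition mult_chars :: "('a::{field,finite} \<Rightarrow> complex) set" where
  "mult_chars = {\<chi>. \<chi> 0 = 0 \<and> (\<forall>x. x \<noteq> 0 \<longrightarrow> \<chi> x \<noteq> 0) \<and>
                     (\<forall>x y. \<chi> (x * y) = \<chi> x * \<chi> y)}"

definition triv_char :: "'a::{field,finite} \<Rightarrow> complex" where
  "triv_char x = (if x = 0 then 0 else 1)"

definition quad_char :: "'a::{field,finite} \<Rightarrow> complex" where
  "quad_char x = (if x = 0 then 0 else if (\<exists>y. y ^ 2 = x) then 1 else -1)"

text \<open>Power of a character (with the convention value 0 at 0, also for exponent 0).\<close>
definition char_pow :: "('a::{field,finite} \<Rightarrow> complex) \<Rightarrow> nat \<Rightarrow> 'a \<Rightarrow> complex" where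
  "char_pow T k x = (if x = 0 then 0 else T x ^ k)"

definition char_mult :: "('a::{field,finite} \<Rightarrow> complex) \<Rightarrow> ('a \<Rightarrow> complex) \<Rightarrow> 'a \<Rightarrow> complex" where
  "char_mult A B x = A x * B x"

definition char_inv :: "('a::{field,finite} \<Rightarrow> complex) \<Rightarrow> 'a \<Rightarrow> complex" where
  "char_inv B x = (if x = 0 then 0 else 1 / B x)"

definition char_generator :: "('a::{field,finite} \<Rightarrow> complex) \<Rightarrow> bool" where
  "char_generator T \<longleftrightarrow> T \<in> mult_chars \<and> (\<forall>\<chi>\<in>mult_chars. \<exists>k. \<chi> = char_pow T k)"

definition char_binom :: "('a::{field,finite} \<Rightarrow> complex) \<Rightarrow> ('a \<Rightarrow> complex) \<Rightarrow> complex" where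
  "char_binom A B = B (-1) / of_nat (card (UNIV :: 'a set)) * (\<Sum>x\<in>UNIV. A x * char_inv B (1 - x))"

text \<open>Gaussian hypergeometric series; As = [A_0,...,A_n], Bs = [B_1,...,B_n].\<close>
definition gauss_hyp :: "('a::{field,finite} \<Rightarrow> complex) list \<Rightarrow> ('a \<Rightarrow> complex) list \<Rightarrow> 'a \<Rightarrow> complex" where
  "gauss_hyp As Bs x =
     of_nat (card (UNIV :: 'a set)) / (of_nat (card (UNIV :: 'a set)) - 1) *
     (\<Sum>\<chi>\<in>mult_chars. char_binom (char_mult (As ! 0) \<chi>) \<chi> *
        (\<Prod>i<length Bs. char_binom (char_mult (As ! (Suc i)) \<chi>) (char_mult (Bs ! i) \<chi>)) * \<chi> x)"

end

theory Submission
  imports Defs "HOL-Algebra.Algebraic_Closure_Type" "HOL-Number_Theory.Residues"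
begin

text \<open>
  Expanding the quadratic character of \<open>x\<^sup>d + a x\<^sup>d\<^sup>-\<^sup>1 + b\<close> in Gauss sums writes the point count as a sum over
  characters \<open>\<Lambda>\<close> of \<open>g(\<Lambda>\<^sup>-\<^sup>1) g(\<Lambda>\<^sup>d) g(\<phi> \<Lambda>\<^sup>1\<^sup>-\<^sup>d)\<close>. Every binomial coefficient in the hypergeometric series is
  a nondegenerate Jacobi sum, and the Hasse--Davenport product formula for \<open>d\<close> and for \<open>d - 1\<close> collapses
  the resulting Gauss sums to the same three factors.

  The product formula is proved with L-functions. Summing \<open>\<psi>\<^sup>m(\<Prod>t) \<theta>(\<Sum>t\<^sup>m)\<close> over the Frobenius stable
  multisets of size \<open>n\<close> in the algebraic closure (that is, over the monic polynomials of degree \<open>n\<close>) gives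
  the \<open>n\<close>-th coefficient of an L-function whose logarithmic derivative counts points over the extensions of
  the base field. Substituting \<open>s = t\<^sup>m\<close> there factors it into the \<open>m\<close> linear L-functions
  \<open>1 + g(\<rho>\<^sup>i \<psi>) X\<close>. The coefficient of \<open>X\<^sup>m\<close> is \<open>\<Prod> g(\<rho>\<^sup>i \<psi>)\<close>; it is also evaluated directly, since the
  power sum \<open>p\<^sub>m\<close> depends on the constant coefficient only through a linear term.
\<close>

hide_const (open) Divisibility.prime \<comment> \<open>otherwise it captures \<open>prime\<close> on \<open>nat\<close>\<close>

subsection \<open>Multisets stable under an injective map\<close>

text \<open>The shape of the parameter rows comes from a degenerate case. At
  \<open>j = d div 2\<close> the pair (\<chi>^j, \<psi>^(2j-1)) would be (\<phi>, \<phi>), whose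
  Jacobi sum is degenerate in every summand. The rows avoid it by crossing: \<phi> stands over the
  trivial lower character of the first binomial and \<epsilon> stands over \<phi>. The top row still
  runs through all powers of \<chi> and the bottom row through all odd powers of \<psi>, and these
  are the two complete families to which the product formula applies. The congruence on q provides
  both characters and keeps d and d - 1 nonzero in the field, where the product formula evaluates
  characters at them. In the product formula, the logarithmic derivative comes from removing one
  Frobenius orbit from a stable multiset, in place of an Euler product over irreducible polynomials.
  The direct evaluation of the top coefficient leaves a constant that is hard to compute but does
  not depend on the character; the trivial character determines it.\<close>

definition orbit_mset :: "('k \<Rightarrow> 'k) \<Rightarrow> nat \<Rightarrow> 'k \<Rightarrow> 'k multiset" where
  "orbit_mset F k t = image_mset (\<lambda>i. (F ^^ i) t) (mset_set {..<k})"

definition stable_msets :: "('k \<Rightarrow> 'k) \<Rightarrow> nat \<Rightarrow> 'k multiset set" where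
  "stable_msets F n = {M. size M = n \<and> image_mset F M = M}"

lemma size_orbit_mset [simp]: "size (orbit_mset F k t) = k"
  by (simp add: orbit_mset_def)

lemma orbit_mset_0 [simp]: "orbit_mset F 0 t = {#}"
  by (simp add: orbit_mset_def)

lemma orbit_mset_Suc: "orbit_mset F (Suc k) t = add_mset ((F ^^ k) t) (orbit_mset F k t)"
  by (simp add: orbit_mset_def lessThan_Suc)

lemma orbit_mset_add:
  "orbit_mset F (k + l) t = orbit_mset F k t + orbit_mset F l ((F ^^ k) t)"
proof (induction l)
  case (Suc l)
  have "(F ^^ (k + l)) t = (F ^^ l) ((F ^^ k) t)"
    by (metis add.commute comp_apply funpow_add)
  then show ?case
    using Suc by (simp add: orbit_mset_Suc)
qed simp

lemma image_orbit_mset: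
  assumes "(F ^^ k) t = t"
  shows "image_mset F (orbit_mset F k t) = orbit_mset F k t"
proof -
  have "add_mset t (image_mset F (orbit_mset F k t)) = orbit_mset F (Suc k) t" for k
    by (induction k) (simp_all add: orbit_mset_Suc)
  then show ?thesis
    using assms by (metis add_mset_add_mset_same_iff orbit_mset_Suc)
qed

lemma funpow_mult_fixed: "(F ^^ s) t = t \<Longrightarrow> (F ^^ (j * s)) t = t"
  by (induction j) (simp_all add: funpow_add)

lemma orbit_mset_mult:
  assumes "(F ^^ s) t = t"
  shows "orbit_mset F (j * s) t = repeat_mset j (orbit_mset F s t)"
proof (induction j)
  case (Suc j)
  then show ?case
    using funpow_mult_fixed[OF assms, of j] assms
    by (simp add: orbit_mset_add)
qed simp

lemma count_funpow_stable:
  assumes "inj F" and "image_mset F M = M"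
  shows "count M ((F ^^ i) t) = count M t"
proof (induction i)
  case (Suc i)
  have "count (image_mset F N) (F u) = count N u" for N u
    using assms(1) by (induction N) (auto simp: inj_eq)
  then have "count M (F u) = count M u" for u
    using assms(2) by metis
  with Suc show ?case by simp
qed simp

text \<open>If \<open>s\<close> is the period of \<open>t\<close>, then \<open>k\<close> must be \<open>j * s\<close>, and its orbit multiset is \<open>j\<close> copies of the orbit of \<open>t\<close>.\<close>

lemma card_orbit_mset_subset:
  assumes "inj F" and M: "image_mset F M = M" and t: "t \<in># M"
  shows "card {k. 1 \<le> k \<and> (F ^^ k) t = t \<and> orbit_mset F k t \<subseteq># M} = count M t"
proof -
  have inM: "(F ^^ i) t \<in># M" for i
    using count_funpow_stable[OF assms(1) M, of i t] t by (metis count_eq_zero_iff)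
  have inj_pow: "inj (F ^^ i)" for i
    using assms(1) by (rule inj_fn)
  \<comment> \<open>All iterates of \<open>t\<close> lie in the finite set of elements of
    \<open>M\<close>, so two of them coincide; injectivity cancels the common iterations.\<close>
  have "\<exists>s\<ge>1. (F ^^ s) t = t"
  proof -
    have "\<not> inj_on (\<lambda>i. (F ^^ i) t) (UNIV :: nat set)"
      using inM by (meson finite_set_mset finite_subset image_subsetI inj_on_finite infinite_UNIV_nat)
    then obtain i j :: nat where ij: "i < j" "(F ^^ i) t = (F ^^ j) t"
      unfolding inj_on_def by (metis linorder_neqE_nat)
    then have "(F ^^ i) ((F ^^ (j - i)) t) = (F ^^ i) t"
      by (metis add_diff_inverse_nat comp_apply funpow_add less_imp_le_nat linorder_not_less)
    then have "(F ^^ (j - i)) t = t"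
      using inj_pow[of i] by (simp add: inj_eq)
    with ij show ?thesis by (intro exI[of _ "j - i"]) auto
  qed
  then obtain s where s: "1 \<le> s" "(F ^^ s) t = t"
    and least: "\<And>k. 1 \<le> k \<Longrightarrow> (F ^^ k) t = t \<Longrightarrow> s \<le> k"
    using exists_least_iff[of "\<lambda>s. 1 \<le> s \<and> (F ^^ s) t = t"] by (metis not_less)
  have period: "s dvd k" if "(F ^^ k) t = t" for k
  proof -
    have "(F ^^ (k mod s)) t = (F ^^ (k mod s)) ((F ^^ (k div s * s)) t)"
      using funpow_mult_fixed[OF s(2)] by simp
    also have "\<dots> = (F ^^ k) t"
      by (metis comp_apply funpow_add mod_div_mult_eq)
    finally have "(F ^^ (k mod s)) t = t"
      using that by simp
    then have "k mod s = 0"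
      using least[of "k mod s"] s(1) mod_less_divisor[of s k] by linarith
    then show ?thesis by auto
  qed
  have distinct: "inj_on (\<lambda>i. (F ^^ i) t) {..<s}"
  proof (rule linorder_inj_onI')
    fix i j assume ij: "i \<in> {..<s}" "j \<in> {..<s}" "i < j"
    show "(F ^^ i) t \<noteq> (F ^^ j) t"
    proof
      assume eq: "(F ^^ i) t = (F ^^ j) t"
      have "(F ^^ i) ((F ^^ (j - i)) t) = (F ^^ i) t"
        using ij eq by (metis add_diff_inverse_nat comp_apply funpow_add less_imp_le_nat linorder_not_less)
      then have "(F ^^ (j - i)) t = t"
        using inj_pow[of i] by (simp add: inj_eq)
      then show False
        using least[of "j - i"] ij by (auto simp: Suc_le_eq)
    qed
  qed
  have orb: "orbit_mset F s t = mset_set ((\<lambda>i. (F ^^ i) t) ` {..<s})"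
    unfolding orbit_mset_def by (rule image_mset_mset_set[OF distinct])
  have sub: "orbit_mset F (j * s) t \<subseteq># M \<longleftrightarrow> j \<le> count M t" for j
  proof
    assume "orbit_mset F (j * s) t \<subseteq># M"
    then have "count (orbit_mset F (j * s) t) t \<le> count M t"
      by (rule mset_subset_eq_count)
    moreover have "t \<in> (\<lambda>i. (F ^^ i) t) ` {..<s}"
      using s(1) by (intro image_eqI[of _ _ 0]) auto
    ultimately show "j \<le> count M t"
      by (simp add: orbit_mset_mult[OF s(2)] orb)
  next
    assume j: "j \<le> count M t"
    show "orbit_mset F (j * s) t \<subseteq># M"
    proof (rule mset_subset_eqI)
      fix u
      show "count (orbit_mset F (j * s) t) u \<le> count M u"
        using j count_funpow_stable[OF assms(1) M, of _ t]
        by (auto simp: orbit_mset_mult[OF s(2)] orb count_mset_set')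
    qed
  qed
  have "{k. 1 \<le> k \<and> (F ^^ k) t = t \<and> orbit_mset F k t \<subseteq># M} = (\<lambda>j. j * s) ` {1..count M t}"
  proof (intro equalityI subsetI)
    fix k assume k: "k \<in> {k. 1 \<le> k \<and> (F ^^ k) t = t \<and> orbit_mset F k t \<subseteq># M}"
    then obtain j where "k = j * s"
      using period by (auto simp: dvd_def mult.commute)
    with k show "k \<in> (\<lambda>j. j * s) ` {1..count M t}"
      using sub[of j] by (intro image_eqI[of _ _ j]) (auto simp: Suc_le_eq)
  next
    fix k assume "k \<in> (\<lambda>j. j * s) ` {1..count M t}"
    then show "k \<in> {k. 1 \<le> k \<and> (F ^^ k) t = t \<and> orbit_mset F k t \<subseteq># M}"
      using sub s funpow_mult_fixed[OF s(2)] by (auto simp: Suc_le_eq)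
  qed
  moreover have "inj_on (\<lambda>j. j * s) {1..count M t}"
    using s(1) by (auto simp: inj_on_def)
  ultimately show ?thesis
    by (simp add: card_image)
qed

text \<open>Double counting. By \<open>card_orbit_mset_subset\<close> the pairs
  \<open>(t, k)\<close> attached to a stable \<open>M\<close> number \<Sum>
  \<open>count M t = n\<close>, which is the factor on the left. Removing the orbit from
  \<open>M\<close> leaves a stable multiset of size \<open>n - k\<close>, and adding it back is the
  inverse operation. In terms of generating series this is \<open>X * S' = T * S\<close>.\<close>

lemma sum_stable_msets_recursion:
  fixes w :: "'k multiset \<Rightarrow> complex"
  assumes "inj F"
    and fin: "\<And>n. finite (stable_msets F n)" "\<And>k. 1 \<le> k \<Longrightarrow> finite {t. (F ^^ k) t = t}"
    and w: "\<And>M N. image_mset F M = M \<Longrightarrow> image_mset F N = N \<Longrightarrow> w (M + N) = w M * w N"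
  shows "of_nat n * (\<Sum>M\<in>stable_msets F n. w M) =
    (\<Sum>k=1..n. (\<Sum>t | (F ^^ k) t = t. w (orbit_mset F k t)) * (\<Sum>M\<in>stable_msets F (n - k). w M))"
proof -
  define P where "P M = (SIGMA t:set_mset M. {k. 1 \<le> k \<and> (F ^^ k) t = t \<and> orbit_mset F k t \<subseteq># M})" for M
  have fink: "finite {k. 1 \<le> k \<and> (F ^^ k) t = t \<and> orbit_mset F k t \<subseteq># M}" if "t \<in># M" for t M
    by (rule finite_subset[of _ "{..size M}"]) (auto dest: size_mset_mono)
  have finP: "finite (P M)" for M
    using fink unfolding P_def by (intro finite_SigmaI) auto
  have cardP: "card (P M) = n" if "M \<in> stable_msets F n" for M
  proof -
    have "card (P M) = (\<Sum>t\<in>set_mset M. count M t)"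
      using that fink card_orbit_mset_subset[OF \<open>inj F\<close>, of M] unfolding P_def
      by (subst card_SigmaI) (auto simp: stable_msets_def)
    then show ?thesis
      using that by (simp add: stable_msets_def size_multiset_overloaded_eq)
  qed
  have "of_nat n * (\<Sum>M\<in>stable_msets F n. w M) = (\<Sum>M\<in>stable_msets F n. \<Sum>x\<in>P M. w M)"
    using cardP by (simp add: sum_distrib_left)
  also have "\<dots> = (\<Sum>(M, t, k)\<in>Sigma (stable_msets F n) P. w M)"
    using fin finP by (subst sum.Sigma) (auto intro!: sum.cong)
  also have "\<dots> = (\<Sum>(k, t, N)\<in>(SIGMA k:{1..n}. {t. (F ^^ k) t = t} \<times> stable_msets F (n - k)).
                   w (orbit_mset F k t) * w N)"
  proof (rule sum.reindex_bij_witness[of _ "\<lambda>(k, t, N). (orbit_mset F k t + N, t, k)"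
        "\<lambda>(M, t, k). (k, t, M - orbit_mset F k t)"], goal_cases)
    case (1 a)
    then show ?case by (auto simp: P_def)
  next
    case (2 a)
    then obtain M t k where a: "a = (M, t, k)" and M: "size M = n" "image_mset F M = M"
      and t: "t \<in># M" "1 \<le> k" "(F ^^ k) t = t" "orbit_mset F k t \<subseteq># M"
      by (auto simp: P_def stable_msets_def)
    have "k \<le> n"
      using size_mset_mono[OF t(4)] M by simp
    then show ?case
      using a M t by (auto simp: stable_msets_def image_mset_Diff image_orbit_mset size_Diff_submset)
  next
    case (3 b)
    then show ?case by auto
  next
    case (4 b)
    then obtain k t N where b: "b = (k, t, N)" and k: "1 \<le> k" "k \<le> n" and t: "(F ^^ k) t = t"
      and N: "size N = n - k" "image_mset F N = N"
      by (auto simp: stable_msets_def)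
    obtain l where l: "k = Suc l" using k by (cases k) auto
    have "t \<in># orbit_mset F k t"
      unfolding orbit_mset_def l by (simp add: image_iff) (metis lessThan_iff funpow_0 zero_less_Suc)
    then show ?case
      using b k t N by (auto simp: stable_msets_def P_def image_orbit_mset)
  next
    case (5 a)
    then obtain M t k where a: "a = (M, t, k)" and M: "size M = n" "image_mset F M = M"
      and t: "t \<in># M" "1 \<le> k" "(F ^^ k) t = t" "orbit_mset F k t \<subseteq># M"
      by (auto simp: P_def stable_msets_def)
    then show ?case
      using w[of "orbit_mset F k t" "M - orbit_mset F k t"]
      by (simp add: image_mset_Diff image_orbit_mset)
  qed
  also have "\<dots> = (\<Sum>k=1..n. \<Sum>(t, N)\<in>{t. (F ^^ k) t = t} \<times> stable_msets F (n - k).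
                   w (orbit_mset F k t) * w N)"
    using fin by (subst sum.Sigma) auto
  also have "\<dots> = (\<Sum>k=1..n. (\<Sum>t | (F ^^ k) t = t. w (orbit_mset F k t)) * (\<Sum>M\<in>stable_msets F (n - k). w M))"
    by (intro sum.cong refl) (simp add: sum_product sum.cartesian_product)
  finally show ?thesis .
qed

text \<open>The quotient \<open>S' * inverse S\<close> has derivative zero, hence is constant, and
  its constant term is 1. This turns an additive identity between point sums into a multiplicative
  one between L-functions without formal exponentials.\<close>

lemma fps_logderiv_unique:
  fixes S S' T :: "complex fps"
  assumes "fps_X * fps_deriv S = T * S" "fps_X * fps_deriv S' = T * S'"
    and "S $ 0 = 1" "S' $ 0 = 1"
  shows "S = S'"
proof -
  have "S * inverse S = 1"
    using assms(3) by (simp add: inverse_mult_eq_1')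
  have "fps_X * (S' * fps_deriv S) = S' * (fps_X * fps_deriv S)"
    by (simp add: mult_ac)
  also have "\<dots> = S * (fps_X * fps_deriv S')"
    unfolding assms(1,2) by (simp add: mult_ac)
  also have "\<dots> = fps_X * (S * fps_deriv S')"
    by (simp add: mult_ac)
  finally have 1: "S' * fps_deriv S = S * fps_deriv S'"
    by simp
  have "fps_deriv (S' * inverse S) = fps_deriv S' * inverse S - (S' * fps_deriv S) * (inverse S * inverse S)"
    using assms(3) by (simp add: fps_inverse_deriv power2_eq_square algebra_simps)
  also have "(S' * fps_deriv S) * (inverse S * inverse S) = fps_deriv S' * inverse S * (S * inverse S)"
    unfolding 1 by (simp add: mult_ac)
  finally have "fps_deriv (S' * inverse S) = 0"
    using \<open>S * inverse S = 1\<close> by simp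
  then have "S' * inverse S = fps_const 1"
    using assms(3,4) by (subst (asm) fps_deriv_eq_0_iff) (simp add: fps_mult_nth)
  then show ?thesis
    using \<open>S * inverse S = 1\<close> by (metis fps_const_1_eq_1 mult.commute mult.left_commute mult.right_neutral)
qed

lemma fps_logderiv_prod:
  fixes S T :: "'i \<Rightarrow> complex fps"
  assumes "finite I" "\<And>i. i \<in> I \<Longrightarrow> fps_X * fps_deriv (S i) = T i * S i"
  shows "fps_X * fps_deriv (\<Prod>i\<in>I. S i) = (\<Sum>i\<in>I. T i) * (\<Prod>i\<in>I. S i)"
  using assms
proof (induction I)
  case (insert i I)
  have "fps_X * fps_deriv (\<Prod>i\<in>insert i I. S i) =
    (fps_X * fps_deriv (S i)) * (\<Prod>i\<in>I. S i) + S i * (fps_X * fps_deriv (\<Prod>i\<in>I. S i))"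
    using insert.hyps by (simp add: algebra_simps)
  also have "\<dots> = (T i * S i) * (\<Prod>i\<in>I. S i) + S i * ((\<Sum>i\<in>I. T i) * (\<Prod>i\<in>I. S i))"
    using insert.prems insert.IH by simp
  also have "\<dots> = (\<Sum>i\<in>insert i I. T i) * (\<Prod>i\<in>insert i I. S i)"
    using insert.hyps by (simp add: algebra_simps)
  finally show ?case .
qed simp

text \<open>The coefficient takes the linear term of every factor; the induction must also carry
  that all coefficients beyond \<open>m\<close> vanish.\<close>

lemma fps_prod_linear_nth:
  fixes g :: "nat \<Rightarrow> complex"
  shows "(\<Prod>i<m. 1 + fps_const (g i) * fps_X) $ m = (\<Prod>i<m. g i)"
proof -
  have "(\<forall>k>m. (\<Prod>i<m. 1 + fps_const (g i) * fps_X) $ k = 0) \<and>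
        (\<Prod>i<m. 1 + fps_const (g i) * fps_X) $ m = (\<Prod>i<m. g i)"
  proof (induction m)
    case (Suc m)
    have "(A * (1 + fps_const (g m) * fps_X)) $ Suc k = A $ Suc k + A $ k * g m" for A k
      by (simp add: distrib_left mult.assoc[symmetric])
    with Suc show ?case
      by (auto simp: Suc_less_eq2)
  qed simp
  then show ?thesis by blast
qed

subsection \<open>Finite fields and their Frobenius map\<close>

lemma cis_root_power_eq_1_iff:
  assumes "0 < n"
  shows "cis (2 * pi / real n) ^ k = 1 \<longleftrightarrow> n dvd k"
proof
  assume "cis (2 * pi / real n) ^ k = 1"
  then have "cis (2 * pi * (real k / real n)) = 1"
    by (simp add: Complex.DeMoivre algebra_simps)
  then have "cos (2 * pi * (real k / real n)) = 1"
    by (metis cis.simps(1) one_complex.simps(1))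
  then obtain z :: int where "2 * pi * (real k / real n) = of_int z * 2 * pi"
    using cos_one_2pi_int by blast
  then have "(2 * pi) * (real k / real n) = (2 * pi) * of_int z"
    by (simp only: mult_ac)
  then have "real k / real n = of_int z"
    by (subst (asm) mult_left_cancel) auto
  then have "real k = of_int (z * int n)"
    using assms by (simp add: field_simps)
  then have "int k = z * int n" by linarith
  then have "int n dvd int k" by simp
  then show "n dvd k" by simp
next
  have "cis (2 * pi / real n) ^ n = 1"
    using assms by (simp add: Complex.DeMoivre)
  moreover assume "n dvd k"
  ultimately show "cis (2 * pi / real n) ^ k = 1"
    by (elim dvdE) (simp only: power_mult power_one)
qed

lemma finite_field_power_card_minus_1:
  fixes x :: "'a::{field,finite}"
  assumes "x \<noteq> 0"
  shows "x ^ (card (UNIV :: 'a set) - 1) = 1"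
proof -
  have "(\<Prod>y\<in>UNIV - {0}. x * y) = (\<Prod>y\<in>UNIV - {0 :: 'a}. y)"
    by (rule prod.reindex_bij_witness[of _ "\<lambda>y. y / x" "\<lambda>y. x * y"]) (use assms in auto)
  then have "x ^ (card (UNIV :: 'a set) - 1) * \<Prod>(UNIV - {0 :: 'a}) = 1 * \<Prod>(UNIV - {0 :: 'a})"
    by (simp add: prod.distrib)
  moreover have "\<Prod>(UNIV - {0 :: 'a}) \<noteq> 0"
    by (simp add: prod_zero_iff)
  ultimately show ?thesis
    using mult_right_cancel by blast
qed

lemma finite_field_power_card:
  fixes x :: "'a::{field,finite}"
  shows "x ^ card (UNIV :: 'a set) = x"
proof -
  have "card (UNIV :: 'a set) \<noteq> 0" by simp
  then obtain n where "card (UNIV :: 'a set) = Suc n" by (cases "card (UNIV :: 'a set)") auto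
  then show ?thesis
    using finite_field_power_card_minus_1[of x] by (cases "x = 0") auto
qed

lemma finite_field_card_ge_2: "2 \<le> card (UNIV :: 'a::{field,finite} set)"
  using card_mono[of UNIV "{0, 1 :: 'a}"] by simp

section \<open>Cyclicity of the multiplicative group\<close>

lemma power_mod_period:
  fixes x :: "'b::monoid_mult"
  assumes "x ^ n = 1"
  shows "x ^ i = x ^ (i mod n)"
proof -
  have "x ^ i = x ^ (n * (i div n) + i mod n)" by simp
  also have "\<dots> = (x ^ n) ^ (i div n) * x ^ (i mod n)" by (simp only: power_add power_mult)
  finally show ?thesis using assms by simp
qed

definition primitive_element :: "'a::{field,finite} \<Rightarrow> bool" where
  "primitive_element g \<longleftrightarrow> g \<noteq> 0 \<and> (\<forall>x. x \<noteq> 0 \<longrightarrow> (\<exists>i::nat. x = g ^ i)) \<and>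
     (\<forall>i j. g ^ i = g ^ j \<longleftrightarrow> i mod (card (UNIV :: 'a set) - 1) = j mod (card (UNIV :: 'a set) - 1))"

lemma primitive_elementD:
  fixes g :: "'a::{field,finite}"
  assumes "primitive_element g"
  shows "g \<noteq> 0" "x \<noteq> 0 \<Longrightarrow> \<exists>i::nat. x = g ^ i"
    "g ^ i = g ^ j \<longleftrightarrow> i mod (card (UNIV :: 'a set) - 1) = j mod (card (UNIV :: 'a set) - 1)"
  using assms by (auto simp: primitive_element_def)

lemma primitive_element_exists: "\<exists>g :: 'a::{field,finite}. primitive_element g"
proof -
  let ?R = "ring_of_type_algebra :: 'a ring"
  interpret R: field ?R by (rule field_from_type_algebra)
  have pow: "x [^]\<^bsub>?R\<^esub> i = x ^ i" for x :: 'a and i :: nat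
    by (induction i) (simp_all add: ring_of_type_algebra_def nat_pow_def)
  obtain g where "g \<in> carrier (mult_of ?R)"
      and *: "carrier (mult_of ?R) = {g [^]\<^bsub>?R\<^esub> i | i::nat. i \<in> UNIV}"
    using R.finite_field_mult_group_has_gen by (auto simp: ring_of_type_algebra_def)
  moreover have "carrier (mult_of ?R) = UNIV - {0}"
    by (auto simp: mult_of_def ring_of_type_algebra_def)
  ultimately have g: "g \<noteq> 0" "\<And>x. x \<noteq> 0 \<Longrightarrow> \<exists>i::nat. x = g ^ i"
    unfolding pow by blast+
  let ?q = "card (UNIV :: 'a set)"
  have q1: "?q - 1 > 0" using finite_field_card_ge_2[where 'a='a] by simp
  note gmod = power_mod_period[OF finite_field_power_card_minus_1[OF g(1)]]
  have "UNIV - {0} \<subseteq> (\<lambda>i. g ^ i) ` {..<?q - 1}"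
  proof
    fix x :: 'a assume "x \<in> UNIV - {0}"
    then obtain i where "x = g ^ i" using g(2) by blast
    then show "x \<in> (\<lambda>i. g ^ i) ` {..<?q - 1}"
      using gmod[of i] q1 by (intro image_eqI[of _ _ "i mod (?q - 1)"]) auto
  qed
  \<comment> \<open>Covering the q - 1 nonzero elements by q - 1 exponents leaves no room for
    repetitions.\<close>
  then have "card (UNIV - {0 :: 'a}) \<le> card ((\<lambda>i. g ^ i) ` {..<?q - 1})"
    by (intro card_mono) auto
  then have "card ((\<lambda>i. g ^ i) ` {..<?q - 1}) = card {..<?q - 1}"
    using card_image_le[of "{..<?q - 1}" "\<lambda>i. g ^ i"] by simp
  then have inj: "inj_on (\<lambda>i. g ^ i) {..<?q - 1}"
    by (intro eq_card_imp_inj_on) auto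
  have "g ^ i = g ^ j \<longleftrightarrow> i mod (?q - 1) = j mod (?q - 1)" for i j
  proof -
    have "g ^ i = g ^ j \<longleftrightarrow> g ^ (i mod (?q - 1)) = g ^ (j mod (?q - 1))"
      using gmod by metis
    also have "\<dots> \<longleftrightarrow> i mod (?q - 1) = j mod (?q - 1)"
      using inj q1 by (auto simp: inj_on_eq_iff)
    finally show ?thesis .
  qed
  with g show ?thesis
    unfolding primitive_element_def by blast
qed

lemma card_roots_power_eq_same_le:
  fixes n :: nat
  assumes "2 \<le> n"
  shows "finite {x::'a::field. x ^ n = x}" "card {x::'a::field. x ^ n = x} \<le> n"
proof -
  let ?P = "Polynomial.monom 1 n - Polynomial.monom 1 1 :: 'a poly"
  have deg: "Polynomial.degree ?P = n"
    using assms degree_add_eq_left[of "- Polynomial.monom 1 1" "Polynomial.monom 1 n :: 'a poly"]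
    by (simp add: degree_monom_eq)
  then have "?P \<noteq> 0" using assms by auto
  moreover have "{x. poly ?P x = 0} = {x. x ^ n = x}"
    by (simp add: poly_monom)
  ultimately show "finite {x::'a. x ^ n = x}" "card {x::'a. x ^ n = x} \<le> n"
    using poly_roots_finite[of ?P] card_poly_roots_bound[of ?P] deg by auto
qed

section \<open>The Frobenius map on the algebraic closure\<close>

definition frob :: "'a::{field,finite} alg_closure \<Rightarrow> 'a alg_closure" where
  "frob t = t ^ card (UNIV :: 'a set)"

lemma frob_funpow:
  fixes t :: "'a::{field,finite} alg_closure"
  shows "(frob ^^ k) t = t ^ (card (UNIV :: 'a set) ^ k)"
  by (induction k) (simp_all add: frob_def mult.commute flip: power_mult)

lemma finite_frob_fixed: "1 \<le> k \<Longrightarrow> finite {t :: 'a::{field,finite} alg_closure. (frob ^^ k) t = t}"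
  unfolding frob_funpow
  using finite_field_card_ge_2[where 'a='a]
  by (intro card_roots_power_eq_same_le(1) order.trans[OF _ self_le_power]) auto

text \<open>The base field already supplies q roots of X^q - X, which has no more. This is the
  descent criterion for products, power sums and polynomial coefficients.\<close>

lemma frob_eq_iff: "frob t = t \<longleftrightarrow> t \<in> range to_ac"
  for t :: "'a::{field,finite} alg_closure"
proof -
  have sub: "range to_ac \<subseteq> {t :: 'a alg_closure. frob t = t}"
    by (auto simp: frob_def finite_field_power_card simp flip: to_ac_power)
  have "range to_ac = {t :: 'a alg_closure. frob t = t}"
  proof (rule card_seteq[OF _ sub])
    show "finite {t :: 'a alg_closure. frob t = t}"
      unfolding frob_def by (intro card_roots_power_eq_same_le finite_field_card_ge_2)
    have "card {t :: 'a alg_closure. frob t = t} \<le> card (UNIV :: 'a set)"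
      unfolding frob_def by (intro card_roots_power_eq_same_le finite_field_card_ge_2)
    also have "\<dots> = card (range (to_ac :: 'a \<Rightarrow> 'a alg_closure))"
      by (rule sym, rule card_image, rule inj_to_ac)
    finally show "card {t :: 'a alg_closure. frob t = t} \<le> card (range (to_ac :: 'a \<Rightarrow> 'a alg_closure))" .
  qed
  then show ?thesis by blast
qed

lemma frob_mult [simp]: "frob (x * y) = frob x * frob y"
  by (simp add: frob_def power_mult_distrib)

lemma frob_1 [simp]: "frob 1 = 1"
  by (simp add: frob_def)

lemma frob_power [simp]: "frob (x ^ n) = frob x ^ n"
  by (simp add: frob_def mult.commute flip: power_mult)

lemma frob_0 [simp]: "frob 0 = 0"
  by (simp add: frob_def finite_UNIV_card_ge_0)

lemma frob_eq_0_iff [simp]: "frob x = 0 \<longleftrightarrow> x = 0"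
  by (simp add: frob_def finite_UNIV_card_ge_0)

lemma frob_prod_mset: "frob (\<Prod>x\<in>#M. f x) = (\<Prod>x\<in>#M. frob (f x))"
  by (induction M) auto

section \<open>Additivity of the Frobenius map, and a nontrivial additive character\<close>

definition prime_power_card :: "'a::{field,finite} itself \<Rightarrow> bool" where
  "prime_power_card _ \<longleftrightarrow> (\<exists>n. card (UNIV :: 'a set) = CHAR('a) ^ n)"

lemma prime_CHAR_finite_field: "prime CHAR('a::{field,finite})"
  by (intro prime_CHAR_semidom finite_imp_CHAR_pos) auto

lemma prime_power_cardI:
  assumes "prime p" "card (UNIV :: 'a::{field,finite} set) = p ^ n"
  shows "prime_power_card TYPE('a)"
proof -
  have "CHAR('a) dvd p ^ n"
    using CHAR_dvd_CARD[where 'a='a] assms by simp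
  then have "CHAR('a) = p"
    using prime_CHAR_finite_field[where 'a='a] assms(1)
    by (metis prime_dvd_power primes_dvd_imp_eq)
  then show ?thesis
    using assms unfolding prime_power_card_def by auto
qed

context
  assumes pp: "prime_power_card TYPE('a::{field,finite})"
begin



lemma frob_add [simp]: "frob (x + y) = frob x + frob y" for x y :: "'a alg_closure"
  using pp prime_CHAR_finite_field[where 'a='a] freshmans_dream'[where 'a="'a alg_closure"]
  unfolding prime_power_card_def frob_def by auto

lemma frob_minus [simp]: "frob (- x) = - frob x" for x :: "'a alg_closure"
  using frob_add[of x "- x"] by (simp add: eq_neg_iff_add_eq_0 add.commute)

lemma frob_diff [simp]: "frob (x - y) = frob x - frob y" for x y :: "'a alg_closure"
  using frob_add[of x "- y"] by simp

lemma inj_frob: "inj (frob :: 'a alg_closure \<Rightarrow> _)"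
proof (rule injI)
  fix x y :: "'a alg_closure" assume "frob x = frob y"
  then have "frob (x - y) = 0" by simp
  then have "x - y = 0" by (simp only: frob_eq_0_iff)
  then show "x = y" by simp
qed

lemma frob_sum_mset: "frob (\<Sum>x\<in>#M. f x) = (\<Sum>x\<in>#M. frob (f x))" for f :: "'b \<Rightarrow> 'a alg_closure"
  by (induction M) auto

text \<open>\<theta> is a primitive p-th root of unity raised to the absolute trace
  \<open>tr\<close>, which takes values in the prime field.\<close>

lemma additive_char_exists:
  obtains \<theta> :: "'a \<Rightarrow> complex"
  where "\<And>x y. \<theta> (x + y) = \<theta> x * \<theta> y" "\<theta> 0 = 1" "\<exists>c. \<theta> c \<noteq> 1"
proof -
  define p where "p = CHAR('a)"
  have p: "prime p" unfolding p_def by (rule prime_CHAR_finite_field)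
  obtain n where n: "card (UNIV :: 'a set) = p ^ n"
    using pp unfolding prime_power_card_def p_def by auto
  have "n \<noteq> 0"
    using n finite_field_card_ge_2[where 'a='a] by (cases n) auto
  define tr :: "'a \<Rightarrow> 'a" where "tr x = (\<Sum>i<n. x ^ (p ^ i))" for x
  have pow_add: "(x + y) ^ (p ^ i) = x ^ (p ^ i) + y ^ (p ^ i)" for x y :: 'a and i
    using freshmans_dream'[of "p ^ i" i x y] prime_CHAR_finite_field[where 'a='a] by (simp add: p_def)
  have tr_add: "tr (x + y) = tr x + tr y" for x y
    by (simp add: tr_def pow_add sum.distrib)
  \<comment> \<open>Raising to the power \<open>p\<close> shifts the conjugates cyclically, since
    x^q = x; adding \<open>x\<close> to both sides lets the shifted sum be compared without
    subtraction.\<close>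
  have tr_fixed: "tr x ^ p = tr x" for x
  proof -
    have "tr x ^ p = (\<Sum>i<n. x ^ (p ^ Suc i))"
      using freshmans_dream_sum[of p "\<lambda>i. x ^ (p ^ i)" "{..<n}"] prime_CHAR_finite_field[where 'a='a]
      by (simp add: p_def tr_def mult.commute flip: power_mult)
    also have "\<dots> + x = (\<Sum>i<Suc n. x ^ (p ^ i))"
      by (subst sum.lessThan_Suc_shift) simp
    also have "\<dots> = tr x + x"
      using finite_field_power_card[of x] by (simp add: tr_def n)
    finally show ?thesis by simp
  qed
  have inj: "inj_on (of_nat :: nat \<Rightarrow> 'a) {..<p}"
    unfolding p_def by (auto simp: inj_on_def of_nat_eq_iff_cong_CHAR cong_def)
  have prime_field: "{x :: 'a. x ^ p = x} = of_nat ` {..<p}"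
  proof (rule sym, rule card_seteq)
    show "finite {x :: 'a. x ^ p = x}" by simp
    have "of_nat k ^ p = (of_nat k :: 'a)" for k
      using freshmans_dream_sum[of p "\<lambda>_. 1 :: 'a" "{..<k}"] prime_CHAR_finite_field[where 'a='a]
      by (simp add: p_def)
    then show "of_nat ` {..<p} \<subseteq> {x :: 'a. x ^ p = x}" by auto
    show "card {x :: 'a. x ^ p = x} \<le> card (of_nat ` {..<p} :: 'a set)"
      using card_roots_power_eq_same_le(2)[of p, where 'a='a] prime_ge_2_nat[OF p] inj
      by (simp add: card_image)
  qed
  \<comment> \<open>Any natural number representing the trace; \<open>cong\<close> below makes
    \<open>\<theta>\<close> independent of the choice.\<close>
  define k where "k x = (SOME k. tr x = of_nat k)" for x
  have k: "tr x = of_nat (k x)" for x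
  proof -
    have "tr x \<in> of_nat ` {..<p}"
      using tr_fixed[of x] prime_field by blast
    then obtain j where "tr x = of_nat j" by auto
    then show ?thesis
      unfolding k_def by (rule someI[of "\<lambda>j. tr x = of_nat j"])
  qed
  define \<theta> where "\<theta> x = cis (2 * pi / of_nat p) ^ k x" for x
  have root: "cis (2 * pi / of_nat p) ^ p = 1"
    using prime_gt_0_nat[OF p] by (simp add: Complex.DeMoivre)
  have cong: "cis (2 * pi / of_nat p) ^ i = cis (2 * pi / of_nat p) ^ j"
    if "of_nat i = (of_nat j :: 'a)" for i j
  proof -
    have "i mod p = j mod p"
      using that by (simp add: p_def of_nat_eq_iff_cong_CHAR cong_def)
    moreover have "cis (2 * pi / of_nat p) ^ i = cis (2 * pi / of_nat p) ^ (i mod p)" for i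
      using root by (metis div_mult_mod_eq mult.commute mult_1 power_add power_mult power_one)
    ultimately show ?thesis by metis
  qed
  have "\<theta> (x + y) = \<theta> x * \<theta> y" for x y
    unfolding \<theta>_def power_add[symmetric]
    by (rule cong) (use tr_add[of x y] in \<open>simp add: k\<close>)
  moreover have "\<theta> 0 = 1"
  proof -
    have "tr 0 = 0" by (simp add: tr_def zero_power prime_gt_0_nat[OF p])
    then show ?thesis
      unfolding \<theta>_def using cong[of "k 0" 0] by (simp add: k)
  qed
  moreover have "\<exists>c. \<theta> c \<noteq> 1"
  proof -
    \<comment> \<open>The trace as a polynomial: its linear coefficient is 1, so it is nonzero, and
      its degree is below q, so it cannot vanish on the whole field.\<close>
    let ?P = "\<Sum>i<n. Polynomial.monom 1 (p ^ i) :: 'a poly"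
    have "Polynomial.coeff ?P 1 = (\<Sum>i<n. if i = 0 then 1 else 0)"
      unfolding coeff_sum using prime_gt_1_nat[OF p] by (intro sum.cong) (auto)
    also have "\<dots> = 1" using \<open>n \<noteq> 0\<close> by simp
    finally have "?P \<noteq> 0" by auto
    have "p ^ i \<le> p ^ (n - 1)" if "i < n" for i
      using that prime_gt_0_nat[OF p] by (intro power_increasing) auto
    then have "Polynomial.degree ?P \<le> p ^ (n - 1)"
      by (intro degree_sum_le) (auto intro: order.trans[OF degree_monom_le])
    also have "\<dots> < p ^ n"
      using prime_gt_1_nat[OF p] \<open>n \<noteq> 0\<close> by simp
    finally have "card {x. poly ?P x = 0} < card (UNIV :: 'a set)"
      using card_poly_roots_bound[OF \<open>?P \<noteq> 0\<close>] n by simp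
    then have "{x. poly ?P x = 0} \<noteq> UNIV" by auto
    then obtain c where c: "poly ?P c \<noteq> 0" by auto
    have "poly ?P c = tr c" by (simp add: poly_sum poly_monom tr_def)
    with c have "of_nat (k c) \<noteq> (0 :: 'a)" by (simp add: k)
    then have "\<not> p dvd k c" by (simp add: p_def of_nat_eq_0_iff_char_dvd)
    then have "\<theta> c \<noteq> 1"
      using cis_root_power_eq_1_iff[of p "k c"] prime_gt_0_nat[OF p] by (simp add: \<theta>_def)
    then show ?thesis by blast
  qed
  ultimately show ?thesis using that by blast
qed

end

subsection \<open>Newton's identities and monic polynomials\<close>

definition root_poly :: "'k::field multiset \<Rightarrow> 'k poly" where
  "root_poly M = (\<Prod>t\<in>#M. [:- t, 1:])"

definition power_sum :: "nat \<Rightarrow> 'k::field multiset \<Rightarrow> 'k" where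
  "power_sum k M = (\<Sum>t\<in>#M. t ^ k)"

lemma root_poly_empty [simp]: "root_poly {#} = 1"
  by (simp add: root_poly_def)

lemma root_poly_add_mset [simp]: "root_poly (add_mset t M) = [:- t, 1:] * root_poly M"
  by (simp add: root_poly_def)

lemma root_poly_nonzero [simp]: "root_poly M \<noteq> 0"
  by (induction M) (simp_all del: mult_pCons_left)

lemma lead_coeff_root_poly: "Polynomial.lead_coeff (root_poly M) = 1"
  by (induction M) (simp_all add: lead_coeff_mult del: mult_pCons_left)

lemma degree_root_poly [simp]: "Polynomial.degree (root_poly M) = size M"
  by (induction M) (simp_all add: degree_mult_eq del: mult_pCons_left)

lemma proots_root_poly [simp]: "proots (root_poly M) = M"
  by (induction M) (simp_all add: proots_mult del: mult_pCons_left)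

lemma poly_root_poly_0: "poly (root_poly M) 0 = (- 1) ^ size M * \<Prod>\<^sub># M"
  by (induction M) simp_all

lemma root_poly_proots:
  fixes P :: "'k::alg_closed_field poly"
  assumes "Polynomial.lead_coeff P = 1"
  shows "root_poly (proots P) = P"
proof -
  have "P \<noteq> 0" using assms by auto
  then obtain A where "P = smult (Polynomial.lead_coeff P) (root_poly A)"
    using alg_closed_imp_factorization[of P] unfolding root_poly_def by blast
  then have "P = root_poly A" using assms by simp
  then show ?thesis by simp
qed

text \<open>The reversed root polynomial, whose coefficient at j is the signed elementary symmetric
  function (-1)^j e_j. Reversing fixes the position of e_j whatever the size of \<open>M\<close>,
  and makes Newton's identities a logarithmic derivative.\<close>

definition rev_root_fps :: "'k::field multiset \<Rightarrow> 'k fps" where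
  "rev_root_fps M = (\<Prod>t\<in>#M. 1 - fps_const t * fps_X)"

lemma rev_root_fps_add_mset: "rev_root_fps (add_mset t M) = rev_root_fps M - fps_const t * (fps_X * rev_root_fps M)"
  by (simp add: rev_root_fps_def algebra_simps)

lemma rev_root_fps_nth:
  "rev_root_fps M $ j = (if j \<le> size M then Polynomial.coeff (root_poly M) (size M - j) else 0)"
proof (induction M arbitrary: j)
  case empty
  then show ?case by (simp add: rev_root_fps_def)
next
  case (add t M)
  show ?case
  proof (cases j)
    case 0
    then show ?thesis
      using add[of 0] lead_coeff_root_poly[of M] coeff_eq_0[of "root_poly M" "Suc (size M)"]
      by (simp add: rev_root_fps_add_mset)
  next
    case (Suc i)
    then show ?thesis
      using add[of i] add[of "Suc i"]
      by (auto simp: rev_root_fps_add_mset coeff_pCons Suc_diff_le diff_Suc split: nat.split)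
  qed
qed

lemma rev_root_fps_nth_0 [simp]: "rev_root_fps M $ 0 = 1"
  using lead_coeff_root_poly[of M] by (simp add: rev_root_fps_nth)

text \<open>Logarithmic derivatives add over the factors, and X times that of 1 - tX is minus the
  geometric series of the t^k X^k with k \<ge> 1.\<close>

lemma newton_identity_fps:
  "fps_X * fps_deriv (rev_root_fps M) = - (rev_root_fps M * Abs_fps (\<lambda>k. if k = 0 then 0 else power_sum k M))"
proof (induction M)
  case empty
  have "Abs_fps (\<lambda>k. if k = 0 then 0 else power_sum k {#}) = (0 :: 'a fps)"
    by (rule fps_ext) (simp add: power_sum_def)
  then show ?case by (simp add: rev_root_fps_def)
next
  case (add t M)
  let ?G = "\<lambda>M. Abs_fps (\<lambda>k. if k = 0 then 0 else power_sum k M)"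
  let ?l = "1 - fps_const t * fps_X"
  have R: "rev_root_fps (add_mset t M) = ?l * rev_root_fps M"
    by (simp add: rev_root_fps_def)
  have G: "?G (add_mset t M) = ?G M + ?G {#t#}"
    by (rule fps_ext) (simp add: power_sum_def)
  have lG: "?l * ?G {#t#} = fps_const t * fps_X"
  proof (rule fps_ext)
    fix n
    show "(?l * ?G {#t#}) $ n = (fps_const t * fps_X) $ n"
      by (cases n) (auto simp: left_diff_distrib mult.assoc power_sum_def)
  qed
  have "fps_X * fps_deriv (rev_root_fps (add_mset t M)) =
      - (fps_const t * fps_X) * rev_root_fps M + ?l * (fps_X * fps_deriv (rev_root_fps M))"
    unfolding R by (simp add: algebra_simps)
  also have "\<dots> = - (?l * ?G {#t#}) * rev_root_fps M - ?l * (rev_root_fps M * ?G M)"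
    unfolding add lG by simp
  also have "\<dots> = - (rev_root_fps (add_mset t M) * ?G (add_mset t M))"
    unfolding R G by (simp add: algebra_simps)
  finally show ?case .
qed

lemma newton_identity:
  assumes "1 \<le> k"
  shows "power_sum k M = - of_nat k * rev_root_fps M $ k - (\<Sum>j=1..<k. rev_root_fps M $ j * power_sum (k - j) M)"
proof -
  let ?g = "\<lambda>k. if k = 0 then 0 else power_sum k M"
  have "of_nat k * rev_root_fps M $ k = (fps_X * fps_deriv (rev_root_fps M)) $ k"
    using assms by (cases k) simp_all
  also have "\<dots> = - (\<Sum>j=0..k. rev_root_fps M $ j * ?g (k - j))"
    unfolding newton_identity_fps by (simp add: fps_mult_nth)
  also have "(\<Sum>j=0..k. rev_root_fps M $ j * ?g (k - j)) =
      power_sum k M + (\<Sum>j=1..k. rev_root_fps M $ j * ?g (k - j))"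
    using assms by (subst sum.atLeast_Suc_atMost) auto
  also have "(\<Sum>j=1..k. rev_root_fps M $ j * ?g (k - j)) = (\<Sum>j=1..<k. rev_root_fps M $ j * power_sum (k - j) M)"
    using assms by (intro sum.mono_neutral_cong_right) auto
  finally have "power_sum k M + (\<Sum>j=1..<k. rev_root_fps M $ j * power_sum (k - j) M) =
      - (of_nat k * rev_root_fps M $ k)"
    by (metis minus_minus)
  then show ?thesis
    by (simp add: eq_diff_eq)
qed

text \<open>Newton's identities express p_k through e_1, ..., e_k without dividing by k, so this
  holds in every characteristic.\<close>

lemma power_sum_cong:
  assumes "\<And>j. j \<le> k \<Longrightarrow> rev_root_fps M $ j = rev_root_fps N $ j" "1 \<le> k"
  shows "power_sum k M = power_sum k N"
  using assms
proof (induction k rule: less_induct)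
  case (less k)
  have "(\<Sum>j=1..<k. rev_root_fps M $ j * power_sum (k - j) M) = (\<Sum>j=1..<k. rev_root_fps N $ j * power_sum (k - j) N)"
    using less by (intro sum.cong refl arg_cong2[of _ _ _ _ "(*)"]) auto
  then show ?case
    using newton_identity[OF less.prems(2), of M] newton_identity[OF less.prems(2), of N] less.prems(1)[of k]
    by simp
qed

text \<open>In Newton's identity for p_m the mixed products involve only coefficients below m; the
  m-th one enters solely through the term with factor m.\<close>

lemma power_sum_diff:
  assumes "\<And>j. j < m \<Longrightarrow> rev_root_fps M $ j = rev_root_fps N $ j" "1 \<le> m"
  shows "power_sum m N = power_sum m M - of_nat m * (rev_root_fps N $ m - rev_root_fps M $ m)"
proof -
  have "(\<Sum>j=1..<m. rev_root_fps N $ j * power_sum (m - j) N) = (\<Sum>j=1..<m. rev_root_fps M $ j * power_sum (m - j) M)"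
    using assms by (intro sum.cong refl arg_cong2[of _ _ _ _ "(*)"] power_sum_cong) auto
  then show ?thesis
    by (subst newton_identity[OF assms(2), of N], subst newton_identity[OF assms(2), of M])
       (simp add: algebra_simps)
qed

section \<open>Monic polynomials as Frobenius stable multisets of roots\<close>

definition monic_polys :: "nat \<Rightarrow> 'a::field poly set" where
  "monic_polys n = {P. Polynomial.degree P = n \<and> Polynomial.lead_coeff P = 1}"

lemma finite_monic_polys: "finite (monic_polys n :: 'a::{field,finite} poly set)"
proof -
  define f where "f P = map (Polynomial.coeff P) [0..<Suc n]" for P :: "'a poly"
  have "length (f P) = Suc n" for P
    by (simp only: f_def length_map length_upt diff_zero)
  then have "f ` monic_polys n \<subseteq> {xs. set xs \<subseteq> UNIV \<and> length xs = Suc n}"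
    by blast
  moreover have "finite {xs :: 'a list. set xs \<subseteq> UNIV \<and> length xs = Suc n}"
    by (rule finite_lists_length_eq) (rule finite_UNIV)
  ultimately have "finite (f ` monic_polys n)"
    by (rule finite_subset)
  moreover have "inj_on f (monic_polys n)"
  proof (rule inj_onI)
    fix P Q assume PQ: "P \<in> monic_polys n" "Q \<in> monic_polys n" "f P = f Q"
    then have "Polynomial.coeff P i = Polynomial.coeff Q i" if "i \<le> n" for i
      using that PQ(3) unfolding f_def map_eq_conv by (simp del: upt_Suc)
    moreover have "Polynomial.coeff P i = Polynomial.coeff Q i" if "i > n" for i
      using that PQ by (auto simp: monic_polys_def coeff_eq_0)
    ultimately show "P = Q"
      by (intro poly_eqI) (meson not_le)
  qed
  ultimately show ?thesis
    by (rule finite_imageD)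
qed

definition ac_roots :: "'a::field poly \<Rightarrow> 'a alg_closure multiset" where
  "ac_roots P = proots (map_poly to_ac P)"

lemma coeff_map_to_ac [simp]: "Polynomial.coeff (map_poly to_ac P) i = to_ac (Polynomial.coeff P i)"
  by (simp add: coeff_map_poly)

lemma degree_map_to_ac [simp]: "Polynomial.degree (map_poly to_ac P) = Polynomial.degree P"
  by (intro degree_map_poly) auto

lemma root_poly_ac_roots:
  assumes "P \<in> monic_polys n"
  shows "root_poly (ac_roots P) = map_poly to_ac P"
  using assms unfolding ac_roots_def
  by (intro root_poly_proots) (auto simp: monic_polys_def)

lemma size_ac_roots:
  assumes "P \<in> monic_polys n"
  shows "size (ac_roots P) = n"
  using arg_cong[OF root_poly_ac_roots[OF assms], of Polynomial.degree] assms
  by (simp add: monic_polys_def)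

lemma rev_root_fps_ac_roots:
  assumes "P \<in> monic_polys n" "j \<le> n"
  shows "rev_root_fps (ac_roots P) $ j = to_ac (Polynomial.coeff P (n - j))"
  using assms by (simp add: rev_root_fps_nth size_ac_roots root_poly_ac_roots)

lemma prod_ac_roots:
  assumes "P \<in> monic_polys n"
  shows "\<Prod>\<^sub># (ac_roots P) = to_ac ((- 1) ^ n * Polynomial.coeff P 0)"
proof -
  have "to_ac (Polynomial.coeff P 0) = (- 1) ^ n * \<Prod>\<^sub># (ac_roots P)"
    using poly_root_poly_0[of "ac_roots P"] assms
    by (simp add: size_ac_roots root_poly_ac_roots poly_0_coeff_0)
  then have "(- 1) ^ n * to_ac (Polynomial.coeff P 0) = ((- 1) ^ n * (- 1) ^ n) * \<Prod>\<^sub># (ac_roots P)"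
    by (simp add: mult.assoc)
  also have "(- 1) ^ n * (- 1) ^ n = (1 :: 'a alg_closure)"
    by (simp flip: power_mult_distrib)
  finally show ?thesis by simp
qed

lemma sum_ac_roots:
  assumes "P \<in> monic_polys n" "1 \<le> n"
  shows "\<Sum>\<^sub># (ac_roots P) = to_ac (- Polynomial.coeff P (n - 1))"
  using newton_identity[of 1 "ac_roots P"] assms
  by (simp add: power_sum_def rev_root_fps_ac_roots)

lemma monic_polys_add:
  assumes "P \<in> monic_polys n" "Polynomial.degree Q < n"
  shows "P + Q \<in> monic_polys n"
  using assms degree_add_eq_left[of Q P] coeff_eq_0[of Q n] by (auto simp: monic_polys_def)

lemma power_sum_ac_roots_add_const:
  assumes "P \<in> monic_polys m" "1 \<le> m"
  shows "power_sum m (ac_roots (P + [:c:])) = power_sum m (ac_roots P) - to_ac (of_nat m * c)"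
proof -
  have "P + [:c:] \<in> monic_polys m"
    using assms by (intro monic_polys_add) auto
  then show ?thesis
    using assms power_sum_diff[of m "ac_roots P" "ac_roots (P + [:c:])"]
    by (simp add: rev_root_fps_ac_roots coeff_pCons split: nat.split)
qed

context
  assumes pp: "prime_power_card TYPE('a::{field,finite})"
begin

lemma map_poly_frob_root_poly:
  fixes M :: "'a alg_closure multiset"
  shows "map_poly frob (root_poly M) = root_poly (image_mset frob M)"
proof (induction M)
  case empty
  show ?case by (simp add: map_poly_1)
next
  case (add t M)
  have "map_poly frob ([:- t, 1:] * P) = [:- frob t, 1:] * map_poly frob P" for P :: "'a alg_closure poly"
    by (rule poly_eqI)
       (auto simp: coeff_map_poly coeff_pCons frob_add[OF pp] frob_minus[OF pp] frob_diff[OF pp] split: nat.split)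
  with add show ?case by (simp del: mult_pCons_left)
qed

text \<open>Applying \<open>frob\<close> to the coefficients of a root polynomial applies it to the
  roots. Hence a multiset is stable exactly when all coefficients are fixed, that is, lie in the
  base field.\<close>

lemma bij_betw_ac_roots:
  "bij_betw ac_roots (monic_polys n :: 'a poly set) (stable_msets frob n)"
  unfolding bij_betw_def
proof
  show "inj_on ac_roots (monic_polys n :: 'a poly set)"
  proof (rule inj_onI)
    fix P Q :: "'a poly" assume PQ: "P \<in> monic_polys n" "Q \<in> monic_polys n" "ac_roots P = ac_roots Q"
    then have "map_poly to_ac P = map_poly to_ac Q"
      by (metis root_poly_ac_roots)
    then have "to_ac (Polynomial.coeff P i) = to_ac (Polynomial.coeff Q i)" for i
      by (metis coeff_map_to_ac)
    then show "P = Q" by (intro poly_eqI) simp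
  qed
  show "ac_roots ` (monic_polys n :: 'a poly set) = stable_msets frob n"
  proof (intro equalityI subsetI)
    fix M :: "'a alg_closure multiset" assume "M \<in> ac_roots ` monic_polys n"
    then obtain P where P: "P \<in> monic_polys n" "M = ac_roots P" by blast
    have "root_poly (image_mset frob M) = map_poly frob (map_poly to_ac P)"
      using P by (simp add: root_poly_ac_roots flip: map_poly_frob_root_poly)
    also have "\<dots> = map_poly to_ac P"
      by (rule poly_eqI) (simp add: coeff_map_poly frob_eq_iff)
    also have "\<dots> = root_poly M"
      using P by (simp add: root_poly_ac_roots)
    finally have "image_mset frob M = M"
      by (metis proots_root_poly)
    then show "M \<in> stable_msets frob n"
      using P size_ac_roots by (simp add: stable_msets_def)
  next
    fix M :: "'a alg_closure multiset" assume M: "M \<in> stable_msets frob n"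
    then have "map_poly frob (root_poly M) = root_poly M"
      by (simp add: stable_msets_def map_poly_frob_root_poly)
    then have "frob (Polynomial.coeff (root_poly M) i) = Polynomial.coeff (root_poly M) i" for i
      by (metis coeff_map_poly frob_0)
    then have coeffs: "to_ac (of_ac (Polynomial.coeff (root_poly M) i)) = Polynomial.coeff (root_poly M) i" for i
      by (simp add: frob_eq_iff to_ac_of_ac)
    define P where "P = map_poly of_ac (root_poly M)"
    have P: "map_poly to_ac P = root_poly M"
      unfolding P_def by (rule poly_eqI) (simp add: coeff_map_poly coeffs)
    then have "Polynomial.degree P = n"
      using M by (metis (mono_tags, lifting) degree_map_to_ac degree_root_poly mem_Collect_eq stable_msets_def)
    moreover from P have "to_ac (Polynomial.lead_coeff P) = 1"
      by (metis coeff_map_to_ac degree_map_to_ac lead_coeff_root_poly)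
    then have "Polynomial.lead_coeff P = 1"
      by (metis to_ac_1 to_ac_eq_iff)
    ultimately have "P \<in> monic_polys n"
      by (simp add: monic_polys_def)
    moreover have "ac_roots P = M"
      by (simp add: ac_roots_def P)
    ultimately show "M \<in> ac_roots ` monic_polys n" by blast
  qed
qed

lemma finite_stable_msets_frob: "finite (stable_msets frob n :: 'a alg_closure multiset set)"
  using bij_betw_ac_roots finite_monic_polys by (metis bij_betw_finite)

lemma sum_stable_msets_frob:
  "(\<Sum>M\<in>stable_msets frob n. h M) = (\<Sum>P\<in>(monic_polys n :: 'a poly set). h (ac_roots P))"
  by (rule sum.reindex_bij_betw[OF bij_betw_ac_roots, symmetric])

end

subsection \<open>L-functions of character sums\<close>

lemma mult_char_0: "\<chi> \<in> mult_chars \<Longrightarrow> \<chi> 0 = 0"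
  by (simp add: mult_chars_def)

lemma mult_char_nonzero: "\<chi> \<in> mult_chars \<Longrightarrow> x \<noteq> 0 \<Longrightarrow> \<chi> x \<noteq> 0"
  by (simp add: mult_chars_def)

lemma mult_char_mult: "\<chi> \<in> mult_chars \<Longrightarrow> \<chi> (x * y) = \<chi> x * \<chi> y"
  by (simp add: mult_chars_def)

lemma mult_char_1:
  assumes "\<chi> \<in> mult_chars"
  shows "\<chi> 1 = 1"
  using mult_char_mult[OF assms, of 1 1] mult_char_nonzero[OF assms, of 1] by simp

lemma mult_char_power: "\<chi> \<in> mult_chars \<Longrightarrow> \<chi> (x ^ n) = \<chi> x ^ n"
  by (induction n) (simp_all add: mult_char_mult mult_char_1)

lemma mult_char_inverse:
  assumes "\<chi> \<in> mult_chars"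
  shows "\<chi> (inverse x) = inverse (\<chi> x)"
proof (cases "x = 0")
  case False
  then have "\<chi> x * \<chi> (inverse x) = 1"
    using assms by (simp add: mult_char_1 flip: mult_char_mult)
  then show ?thesis by (metis inverse_unique)
qed (use assms in \<open>simp add: mult_char_0\<close>)

lemma mult_char_divide: "\<chi> \<in> mult_chars \<Longrightarrow> \<chi> (x / y) = \<chi> x / \<chi> y"
  by (simp add: divide_inverse mult_char_mult mult_char_inverse)

lemma char_mult_in_mult_chars [simp, intro]:
  "A \<in> mult_chars \<Longrightarrow> B \<in> mult_chars \<Longrightarrow> char_mult A B \<in> mult_chars"
  by (auto simp: mult_chars_def char_mult_def)

lemma char_pow_in_mult_chars [simp, intro]: "A \<in> mult_chars \<Longrightarrow> char_pow A k \<in> mult_chars"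
  by (auto simp: mult_chars_def char_pow_def power_mult_distrib)

lemma triv_char_in_mult_chars [simp, intro]: "triv_char \<in> mult_chars"
  by (auto simp: mult_chars_def triv_char_def)

text \<open>Since \<open>m\<close> divides q - 1, the base field contains m distinct m-th roots of
  unity, namely powers of \<open>g ^ c\<close>; they multiply one root \<open>t0\<close> into m of
  them.\<close>

lemma card_roots_power_eq:
  fixes s :: "'a::{field,finite} alg_closure"
  assumes "m dvd card (UNIV :: 'a set) - 1" "1 \<le> m" "s \<noteq> 0"
  shows "finite {t. t ^ m = s}" "card {t. t ^ m = s} = m"
proof -
  let ?q = "card (UNIV :: 'a set)"
  let ?P = "Polynomial.monom 1 m + [:- s:]"
  have "Polynomial.degree [:- s:] < Polynomial.degree (Polynomial.monom (1 :: 'a alg_closure) m)"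
    unfolding degree_pCons_0 using assms(2) by (simp add: degree_monom_eq)
  from degree_add_eq_left[OF this] have deg: "Polynomial.degree ?P = m"
    by (simp add: degree_monom_eq)
  then have "?P \<noteq> 0" using assms(2) by force
  moreover have "{t. poly ?P t = 0} = {t. t ^ m = s}"
    by (simp add: poly_monom)
  ultimately have fin: "finite {t. t ^ m = s}" and le: "card {t. t ^ m = s} \<le> m"
    using poly_roots_finite[of ?P] card_poly_roots_bound[of ?P] deg by auto
  obtain g :: 'a where "primitive_element g" using primitive_element_exists by blast
  note g = primitive_elementD(1)[OF this] and g_power = primitive_elementD(3)[OF this]
  have q1: "?q - 1 > 0" using finite_field_card_ge_2[where 'a='a] by simp
  obtain c where c: "?q - 1 = m * c" using assms(1) by blast
  have cpos: "0 < c" using q1 c by (cases c) auto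
  obtain t0 where t0: "t0 ^ m = s"
    using nth_root_exists[of m s] assms by auto
  have t00: "t0 \<noteq> 0" using t0 assms by (auto simp: power_0_left)
  let ?h = "\<lambda>i. to_ac (g ^ (c * i)) * t0"
  have "inj_on ?h {..<m}"
  proof (rule inj_onI)
    fix i j assume ij: "i \<in> {..<m}" "j \<in> {..<m}" "?h i = ?h j"
    then have "g ^ (c * i) = g ^ (c * j)"
      using t00 by (metis mult_right_cancel to_ac_eq_iff)
    moreover have "c * i \<in> {..<?q - 1}" "c * j \<in> {..<?q - 1}"
      using ij c cpos by (simp_all add: mult.commute)
    ultimately have "c * i = c * j" using g_power[of "c * i" "c * j"] by simp
    then show "i = j" using cpos by simp
  qed
  moreover have "?h ` {..<m} \<subseteq> {t. t ^ m = s}"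
  proof (safe)
    fix i
    have "(g ^ (c * i)) ^ m = (g ^ (?q - 1)) ^ i"
      unfolding c by (simp add: mult_ac flip: power_mult)
    then show "?h i ^ m = s"
      using finite_field_power_card_minus_1[OF g] t0
      by (simp only: power_mult_distrib to_ac_power[symmetric]) simp
  qed
  ultimately have "m \<le> card {t. t ^ m = s}"
    using card_inj_on_le[of ?h "{..<m}" "{t. t ^ m = s}"] fin by simp
  with fin le show "finite {t. t ^ m = s}" "card {t. t ^ m = s} = m" by auto
qed

locale additive_char =
  fixes \<theta> :: "'a::{field,finite} \<Rightarrow> complex"
  assumes pp: "prime_power_card TYPE('a)"
    and add: "\<theta> (x + y) = \<theta> x * \<theta> y"
    and zero [simp]: "\<theta> 0 = 1"
    and nontrivial: "\<exists>c. \<theta> c \<noteq> 1"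
begin

definition gauss :: "('a \<Rightarrow> complex) \<Rightarrow> complex" where
  "gauss \<chi> = (\<Sum>x\<in>UNIV. \<chi> x * \<theta> x)"

lemma sum_theta: "(\<Sum>x\<in>UNIV. \<theta> x) = 0"
proof -
  obtain c where c: "\<theta> c \<noteq> 1" using nontrivial by blast
  have "(\<Sum>x\<in>UNIV. \<theta> x) = (\<Sum>x\<in>UNIV. \<theta> (c + x))"
    by (rule sum.reindex_bij_witness[of _ "\<lambda>x. c + x" "\<lambda>x. x - c"]) auto
  also have "\<dots> = \<theta> c * (\<Sum>x\<in>UNIV. \<theta> x)"
    by (simp add: add sum_distrib_left)
  finally show ?thesis using c by simp
qed

lemma gauss_triv_char: "gauss triv_char = - 1"
proof -
  have "gauss triv_char = (\<Sum>x\<in>UNIV - {0}. \<theta> x)"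
    unfolding gauss_def by (rule sum.mono_neutral_cong_right) (auto simp: triv_char_def)
  also have "\<dots> = (\<Sum>x\<in>UNIV. \<theta> x) - \<theta> 0"
    by (subst sum_diff1) auto
  finally show ?thesis by (simp add: sum_theta)
qed

lemma gauss_scale:
  assumes "\<chi> \<in> mult_chars" "c \<noteq> 0"
  shows "(\<Sum>x\<in>UNIV. \<chi> x * \<theta> (c * x)) = gauss \<chi> / \<chi> c"
proof -
  have "(\<Sum>x\<in>UNIV. \<chi> x * \<theta> (c * x)) = (\<Sum>x\<in>UNIV. \<chi> (x / c) * \<theta> x)"
    by (rule sum.reindex_bij_witness[of _ "\<lambda>x. x / c" "\<lambda>x. c * x"]) (use assms in auto)
  also have "\<dots> = gauss \<chi> / \<chi> c"
    using assms by (simp add: gauss_def mult_char_divide sum_divide_distrib)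
  finally show ?thesis .
qed

text \<open>For a stable multiset both arguments are Frobenius fixed, so \<open>of_ac\<close> reads
  them back in the base field. Only there is the value meaningful, and \<open>weight_add\<close> is
  restricted accordingly.\<close>

definition weight :: "('a \<Rightarrow> complex) \<Rightarrow> nat \<Rightarrow> 'a alg_closure multiset \<Rightarrow> complex" where
  "weight A m M = A (of_ac (\<Prod>\<^sub># M)) * \<theta> (of_ac (power_sum m M))"

definition Lcoeff :: "('a \<Rightarrow> complex) \<Rightarrow> nat \<Rightarrow> nat \<Rightarrow> complex" where
  "Lcoeff A m n = (\<Sum>M\<in>stable_msets frob n. weight A m M)"

text \<open>\<open>Lcoeff A m\<close> are the coefficients of the L-function, \<open>Lpoint A m\<close> those of \<open>X\<close> times its logarithmic
  derivative: a sum over the points of the extension of degree \<open>k\<close>.\<close>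

definition Lpoint :: "('a \<Rightarrow> complex) \<Rightarrow> nat \<Rightarrow> nat \<Rightarrow> complex" where
  "Lpoint A m k = (if k = 0 then 0 else \<Sum>t | (frob ^^ k) t = t. weight A m (orbit_mset frob k t))"

lemma stable_prod:
  fixes M :: "'a alg_closure multiset"
  assumes "image_mset frob M = M"
  obtains a where "\<Prod>\<^sub># M = to_ac a"
proof -
  have "frob (\<Prod>\<^sub># M) = \<Prod>\<^sub># M"
    using frob_prod_mset[of "\<lambda>x. x" M] assms by simp
  then show ?thesis using that by (auto simp: frob_eq_iff)
qed

lemma stable_power_sum:
  fixes M :: "'a alg_closure multiset"
  assumes "image_mset frob M = M"
  obtains a where "power_sum k M = to_ac a"
proof -
  have "frob (power_sum k M) = (\<Sum>t\<in>#image_mset frob M. t ^ k)"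
    unfolding power_sum_def by (simp add: frob_sum_mset[OF pp] multiset.map_comp comp_def)
  then have "frob (power_sum k M) = power_sum k M"
    using assms by (simp add: power_sum_def)
  then show ?thesis using that by (auto simp: frob_eq_iff)
qed

lemma weight_add:
  assumes A: "A \<in> mult_chars" and M: "image_mset frob M = M" and N: "image_mset frob N = N"
  shows "weight A m (M + N) = weight A m M * weight A m N"
proof -
  obtain a b where ab: "\<Prod>\<^sub># M = to_ac a" "\<Prod>\<^sub># N = to_ac b"
    using stable_prod[OF M] stable_prod[OF N] by metis
  obtain c d where cd: "power_sum m M = to_ac c" "power_sum m N = to_ac d"
    using stable_power_sum[OF M] stable_power_sum[OF N] by metis
  have "\<Prod>\<^sub># (M + N) = to_ac (a * b)" "power_sum m (M + N) = to_ac (c + d)"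
    using ab cd by (simp_all add: power_sum_def)
  then show ?thesis
    unfolding weight_def ab cd by (simp only: of_ac_to_ac mult_char_mult[OF A] add mult_ac)
qed

lemma Lcoeff_0: "A \<in> mult_chars \<Longrightarrow> Lcoeff A m 0 = 1"
proof -
  assume A: "A \<in> mult_chars"
  have "stable_msets frob 0 = {{#} :: 'a alg_closure multiset}"
    by (auto simp: stable_msets_def)
  moreover have "of_ac 1 = (1 :: 'a)" by (metis of_ac_to_ac to_ac_1)
  ultimately show ?thesis
    using A by (simp add: Lcoeff_def weight_def power_sum_def mult_char_1)
qed

lemma Lfun_logderiv:
  assumes "A \<in> mult_chars"
  shows "fps_X * fps_deriv (Abs_fps (Lcoeff A m)) = Abs_fps (Lpoint A m) * Abs_fps (Lcoeff A m)"
proof (rule fps_ext)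
  fix n
  have "(fps_X * fps_deriv (Abs_fps (Lcoeff A m))) $ n = of_nat n * Lcoeff A m n"
    by (cases n) simp_all
  also have "\<dots> = (\<Sum>k=1..n. Lpoint A m k * Lcoeff A m (n - k))"
    unfolding Lcoeff_def
    using sum_stable_msets_recursion[OF inj_frob[OF pp] finite_stable_msets_frob[OF pp] finite_frob_fixed,
        of "weight A m" n] weight_add[OF assms]
    by (simp add: Lpoint_def)
  \<comment> \<open>The default value 0 of \<open>Lpoint\<close> at \<open>k = 0\<close> completes
    the recursion to a Cauchy product.\<close>
  also have "\<dots> = (\<Sum>k=0..n. Lpoint A m k * Lcoeff A m (n - k))"
    by (rule sum.mono_neutral_left) (auto simp: Lpoint_def)
  finally show "(fps_X * fps_deriv (Abs_fps (Lcoeff A m))) $ n = (Abs_fps (Lpoint A m) * Abs_fps (Lcoeff A m)) $ n"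
    by (simp add: fps_mult_nth)
qed

lemma weight_ac_roots_1:
  assumes "P \<in> monic_polys n" "1 \<le> n"
  shows "weight A 1 (ac_roots P) = A ((- 1) ^ n * Polynomial.coeff P 0) * \<theta> (- Polynomial.coeff P (n - 1))"
  using assms by (simp add: weight_def power_sum_def prod_ac_roots sum_ac_roots del: to_ac_mult to_ac_minus)

lemma Lcoeff_1_1: "Lcoeff A 1 1 = gauss A"
proof -
  have "Lcoeff A 1 1 = (\<Sum>P\<in>monic_polys 1. A ((- 1) ^ 1 * Polynomial.coeff P 0) * \<theta> (- Polynomial.coeff P (1 - 1)))"
    unfolding Lcoeff_def sum_stable_msets_frob[OF pp]
    by (intro sum.cong refl weight_ac_roots_1) auto
  also have "\<dots> = (\<Sum>x\<in>UNIV. A x * \<theta> x)"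
  proof (rule sum.reindex_bij_witness[of _ "\<lambda>x. [:- x, 1:]" "\<lambda>P. - Polynomial.coeff P 0"])
    fix P :: "'a poly" assume "P \<in> monic_polys 1"
    then show "[:- (- Polynomial.coeff P 0), 1:] = P"
      by (intro poly_eqI) (auto simp: monic_polys_def coeff_pCons coeff_eq_0 split: nat.split)
  qed (auto simp: monic_polys_def)
  finally show ?thesis by (simp add: gauss_def)
qed

text \<open>Translating the coefficient of \<open>X ^ (n - 1)\<close> multiplies every summand by the same \<open>\<theta> c \<noteq> 1\<close>.\<close>

lemma Lcoeff_1_ge_2:
  assumes "2 \<le> n"
  shows "Lcoeff A 1 n = 0"
proof -
  define f where "f P = A ((- 1) ^ n * Polynomial.coeff P 0) * \<theta> (- Polynomial.coeff P (n - 1))" for P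
  have L: "Lcoeff A 1 n = (\<Sum>P\<in>monic_polys n. f P)"
    unfolding Lcoeff_def sum_stable_msets_frob[OF pp] f_def
    by (intro sum.cong refl weight_ac_roots_1) (use assms in auto)
  obtain c where c: "\<theta> c \<noteq> 1" using nontrivial by blast
  have deg: "Polynomial.degree (Polynomial.monom b (n - 1)) < n" for b :: 'a
    using assms degree_monom_le[of b "n - 1"] by linarith
  have "(\<Sum>P\<in>monic_polys n. f P) = (\<Sum>P\<in>monic_polys n. \<theta> c * f P)"
  proof (rule sum.reindex_bij_witness[of _ "\<lambda>P. P + Polynomial.monom (- c) (n - 1)" "\<lambda>P. P + Polynomial.monom c (n - 1)"])
    fix P :: "'a poly"
    have "\<theta> (- Polynomial.coeff P (n - 1)) = \<theta> c * \<theta> (- (Polynomial.coeff P (n - 1) + c))"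
      by (simp flip: add)
    then show "\<theta> c * f (P + Polynomial.monom c (n - 1)) = f P"
      using assms by (simp add: f_def)
  qed (use monic_polys_add[OF _ deg] in \<open>auto simp: add.assoc add_monom\<close>)
  also have "\<dots> = \<theta> c * (\<Sum>P\<in>monic_polys n. f P)"
    by (simp add: sum_distrib_left)
  finally show ?thesis using c L by simp
qed

lemma Lfun_1:
  assumes "A \<in> mult_chars"
  shows "Abs_fps (Lcoeff A 1) = 1 + fps_const (gauss A) * fps_X"
proof (rule fps_ext)
  fix n :: nat
  consider "n = 0" | "n = 1" | "2 \<le> (n :: nat)" by linarith
  then show "Abs_fps (Lcoeff A 1) $ n = (1 + fps_const (gauss A) * fps_X) $ n"
    using Lcoeff_0[OF assms, of 1] Lcoeff_1_1[of A] Lcoeff_1_ge_2[of n A] by cases auto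
qed

end

subsection \<open>The Hasse--Davenport product formula\<close>

lemma geometric_sum_nat:
  fixes q :: nat
  assumes "1 \<le> q"
  shows "q ^ k = (q - 1) * (\<Sum>i<k. q ^ i) + 1"
proof (induction k)
  case (Suc k)
  have "(q - 1) * (\<Sum>i<Suc k. q ^ i) + 1 = (q - 1) * q ^ k + q ^ k"
    using Suc by (simp add: distrib_left)
  also have "\<dots> = (q - 1 + 1) * q ^ k"
    by (simp only: distrib_right mult_1)
  also have "\<dots> = q ^ Suc k"
    using assms by simp
  finally show ?case ..
qed simp

lemma orbit_mset_frob_power:
  "orbit_mset frob k (t ^ m) = image_mset (\<lambda>t. t ^ m) (orbit_mset frob k t)"
  by (simp add: orbit_mset_def multiset.map_comp comp_def frob_funpow mult.commute flip: power_mult)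

lemma prod_orbit_mset_frob:
  fixes t :: "'a::{field,finite} alg_closure"
  shows "\<Prod>\<^sub># (orbit_mset frob k t) = t ^ (\<Sum>i<k. card (UNIV :: 'a set) ^ i)"
  by (simp add: orbit_mset_def frob_funpow power_sum flip: prod_unfold_prod_mset)

lemma prod_mset_image_power: "(\<Prod>t\<in>#M. t ^ m) = (\<Prod>\<^sub># M) ^ m" for M :: "'b::comm_monoid_mult multiset"
  by (induction M) (simp_all add: power_mult_distrib)

text \<open>The order is recorded through the kernel, because counting m-th roots in an extension
  comes down to testing whether a norm raised to \<open>(q - 1) div m\<close> equals 1.\<close>

definition exact_order_char :: "('a::{field,finite} \<Rightarrow> complex) \<Rightarrow> nat \<Rightarrow> bool" where
  "exact_order_char \<rho> m \<longleftrightarrow> \<rho> \<in> mult_chars \<and> 1 \<le> m \<and> m dvd card (UNIV :: 'a set) - 1 \<and>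
     (\<forall>x. x \<noteq> 0 \<longrightarrow> \<rho> x ^ m = 1 \<and> (\<rho> x = 1 \<longleftrightarrow> x ^ ((card (UNIV :: 'a set) - 1) div m) = 1))"

context additive_char
begin

lemma weight_power:
  assumes A: "A \<in> mult_chars" and M: "image_mset frob M = M" and m: "1 \<le> m"
  shows "weight (char_pow A m) m M = weight A 1 (image_mset (\<lambda>t. t ^ m) M)"
proof -
  obtain a where a: "\<Prod>\<^sub># M = to_ac a" using stable_prod[OF M] .
  have "\<Prod>\<^sub># (image_mset (\<lambda>t. t ^ m) M) = to_ac (a ^ m)"
    by (simp add: prod_mset_image_power a)
  moreover have "power_sum 1 (image_mset (\<lambda>t. t ^ m) M) = power_sum m M"
    by (simp add: power_sum_def multiset.map_comp comp_def)
  moreover have "A (a ^ m) = char_pow A m a"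
    using m mult_char_0[OF A] by (auto simp: mult_char_power[OF A] char_pow_def)
  ultimately show ?thesis
    by (simp only: weight_def a of_ac_to_ac)
qed

text \<open>All \<open>m\<close>-th roots \<open>t\<close> of \<open>s\<close> satisfy \<open>t ^ (q ^ k - 1) = N(s) ^ ((q - 1) div m)\<close>, \<open>N\<close> the norm, so either
  all or none of them lie in the extension of degree \<open>k\<close>.\<close>

lemma card_power_fiber:
  fixes s :: "'a alg_closure"
  assumes \<rho>: "exact_order_char \<rho> m" and s: "s \<noteq> 0" "(frob ^^ k) s = s"
  shows "of_nat (card {t. (frob ^^ k) t = t \<and> t ^ m = s}) =
    (\<Sum>i<m. \<rho> (of_ac (\<Prod>\<^sub># (orbit_mset frob k s))) ^ i)"
proof -
  let ?q = "card (UNIV :: 'a set)"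
  have m: "1 \<le> m" "m dvd ?q - 1" using \<rho> by (auto simp: exact_order_char_def)
  define \<Sigma> where "\<Sigma> = (\<Sum>i<k. ?q ^ i)"
  define c where "c = (?q - 1) div m"
  have c: "?q - 1 = m * c" using m by (simp add: c_def)
  obtain a where a: "\<Prod>\<^sub># (orbit_mset frob k s) = to_ac a"
    using stable_prod[OF image_orbit_mset[OF s(2)]] .
  then have sa: "s ^ \<Sigma> = to_ac a"
    by (simp add: prod_orbit_mset_frob \<Sigma>_def)
  have a0: "a \<noteq> 0"
  proof
    assume "a = 0"
    then have "s ^ \<Sigma> = 0" using sa by simp
    then show False using s(1) by simp
  qed
  have iff: "(frob ^^ k) t = t \<longleftrightarrow> \<rho> a = 1" if t: "t ^ m = s" for t
  proof -
    have t0: "t \<noteq> 0" using t s m by (auto simp: power_0_left)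
    have "?q ^ k = m * (\<Sigma> * c) + 1"
      using geometric_sum_nat[of ?q k] finite_field_card_ge_2[where 'a='a] c
      by (simp add: \<Sigma>_def mult_ac)
    then have "(frob ^^ k) t = (t ^ m) ^ (\<Sigma> * c) * t"
      by (simp only: frob_funpow power_add power_mult power_one_right)
    also have "(t ^ m) ^ (\<Sigma> * c) = to_ac (a ^ c)"
      by (simp only: t power_mult sa to_ac_power)
    finally have "(frob ^^ k) t = t \<longleftrightarrow> to_ac (a ^ c) = 1"
      using t0 by simp
    also have "\<dots> \<longleftrightarrow> a ^ c = 1"
      by (metis to_ac_1 to_ac_eq_iff)
    finally show ?thesis
      using \<rho> a0 by (simp add: exact_order_char_def c_def)
  qed
  show ?thesis
  proof (cases "\<rho> a = 1")
    case True
    then have "{t. (frob ^^ k) t = t \<and> t ^ m = s} = {t. t ^ m = s}"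
      using iff by blast
    then show ?thesis
      using True card_roots_power_eq(2)[OF m(2,1) s(1)] by (simp add: a)
  next
    case False
    then have "{t. (frob ^^ k) t = t \<and> t ^ m = s} = {}"
      using iff by blast
    moreover have "\<rho> a ^ m = 1"
      using \<rho> a0 by (simp add: exact_order_char_def)
    then have "(\<Sum>i<m. \<rho> a ^ i) = 0"
      using False by (simp add: geometric_sum)
    ultimately show ?thesis by (simp only: card.empty of_nat_0 a of_ac_to_ac)
  qed
qed

text \<open>Zero is fixed by every power of Frobenius, but characters, including the trivial one,
  vanish there. The count of m-th roots may thus be confined to nonzero \<open>s\<close>.\<close>

lemma weight_orbit_0:
  assumes "A \<in> mult_chars" "k \<noteq> 0"
  shows "weight A m (orbit_mset frob k 0) = 0"
proof -
  have "(\<Sum>i<k. card (UNIV :: 'a set) ^ i) \<noteq> 0"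
    using assms(2) by (auto simp: lessThan_empty_iff)
  then have "\<Prod>\<^sub># (orbit_mset frob k (0 :: 'a alg_closure)) = 0"
    by (simp add: prod_orbit_mset_frob power_0_left)
  then show ?thesis
    by (simp only: weight_def of_ac_0 mult_char_0[OF assms(1)] mult_zero_left)
qed

text \<open>The points \<open>t\<close> are grouped by \<open>s = t ^ m\<close>. The size of each
  group is the sum of the \<rho>^i at the norm of \<open>s\<close>, and multiplying the weight by
  \<rho>^i of the norm only twists the character.\<close>

lemma Lpoint_power:
  assumes A: "A \<in> mult_chars" and \<rho>: "exact_order_char \<rho> m"
  shows "Lpoint (char_pow A m) m k = (\<Sum>i<m. Lpoint (char_mult (char_pow \<rho> i) A) 1 k)"
proof (cases "k = 0")
  case False
  define E where "E = {t :: 'a alg_closure. (frob ^^ k) t = t} - {0}"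
  have m: "1 \<le> m" and \<rho>': "\<rho> \<in> mult_chars" using \<rho> by (auto simp: exact_order_char_def)
  have fin: "finite {t :: 'a alg_closure. (frob ^^ k) t = t}"
    using False by (intro finite_frob_fixed) simp
  then have finE: "finite E" by (simp add: E_def)
  have L: "Lpoint B n k = (\<Sum>t\<in>E. weight B n (orbit_mset frob k t))" if "B \<in> mult_chars" for B n
    using False fin weight_orbit_0[OF that False] unfolding Lpoint_def E_def
    by (auto intro!: sum.mono_neutral_right)
  have powE: "t ^ m \<in> E" if "t \<in> E" for t
  proof -
    have "(frob ^^ k) (t ^ m) = ((frob ^^ k) t) ^ m"
      by (simp add: frob_funpow mult.commute flip: power_mult)
    then show ?thesis using that by (simp add: E_def)
  qed
  have "(\<Sum>i<m. Lpoint (char_mult (char_pow \<rho> i) A) 1 k) =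
      (\<Sum>i<m. \<Sum>s\<in>E. weight (char_mult (char_pow \<rho> i) A) 1 (orbit_mset frob k s))"
    using A \<rho>' by (intro sum.cong refl L) auto
  also have "\<dots> = (\<Sum>s\<in>E. \<Sum>i<m. weight (char_mult (char_pow \<rho> i) A) 1 (orbit_mset frob k s))"
    by (rule sum.swap)
  \<comment> \<open>The sum over \<open>i\<close> of the twists is the number of m-th roots of
    \<open>s\<close> in the extension, written as that many equal summands.\<close>
  also have "\<dots> = (\<Sum>s\<in>E. \<Sum>t\<in>{t\<in>E. t ^ m = s}. weight A 1 (orbit_mset frob k (t ^ m)))"
  proof (rule sum.cong[OF refl])
    fix s assume "s \<in> E"
    then have s: "s \<noteq> 0" "(frob ^^ k) s = s" by (auto simp: E_def)
    obtain a where a: "\<Prod>\<^sub># (orbit_mset frob k s) = to_ac a"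
      using stable_prod[OF image_orbit_mset[OF s(2)]] .
    have "to_ac a \<noteq> 0" using s(1) by (simp add: prod_orbit_mset_frob flip: a)
    then have a0: "a \<noteq> 0" by (simp only: to_ac_eq_0_iff not_False_eq_True)
    have "(\<Sum>i<m. weight (char_mult (char_pow \<rho> i) A) 1 (orbit_mset frob k s)) =
        (\<Sum>i<m. \<rho> (of_ac (\<Prod>\<^sub># (orbit_mset frob k s))) ^ i) * weight A 1 (orbit_mset frob k s)"
      unfolding sum_distrib_right
      by (intro sum.cong refl) (simp add: weight_def a char_mult_def char_pow_def a0)
    also have "\<dots> = of_nat (card {t. (frob ^^ k) t = t \<and> t ^ m = s}) * weight A 1 (orbit_mset frob k s)"
      using card_power_fiber[OF \<rho> s] by simp
    also have "{t. (frob ^^ k) t = t \<and> t ^ m = s} = {t\<in>E. t ^ m = s}"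
      using s m by (auto simp: E_def power_0_left)
    also have "of_nat (card {t\<in>E. t ^ m = s}) * weight A 1 (orbit_mset frob k s) =
        (\<Sum>t\<in>{t\<in>E. t ^ m = s}. weight A 1 (orbit_mset frob k (t ^ m)))"
      by simp
    finally show "(\<Sum>i<m. weight (char_mult (char_pow \<rho> i) A) 1 (orbit_mset frob k s)) =
        (\<Sum>t\<in>{t\<in>E. t ^ m = s}. weight A 1 (orbit_mset frob k (t ^ m)))" .
  qed
  also have "\<dots> = (\<Sum>t\<in>E. weight A 1 (orbit_mset frob k (t ^ m)))"
    by (rule sum.group) (use finE powE in auto)
  also have "\<dots> = (\<Sum>t\<in>E. weight (char_pow A m) m (orbit_mset frob k t))"
    unfolding orbit_mset_frob_power
    by (intro sum.cong refl weight_power[symmetric] A m image_orbit_mset) (simp add: E_def)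
  also have "\<dots> = Lpoint (char_pow A m) m k"
    using A by (intro L[symmetric]) auto
  finally show ?thesis ..
qed (simp add: Lpoint_def)

text \<open>By \<open>Lpoint_power\<close> the logarithmic derivatives add, so the L-functions
  multiply; the coefficient at \<open>m\<close> of a product of m linear factors is the product of
  their slopes.\<close>

lemma prod_gauss_eq_Lcoeff:
  assumes A: "A \<in> mult_chars" and \<rho>: "exact_order_char \<rho> m"
  shows "(\<Prod>i<m. gauss (char_mult (char_pow \<rho> i) A)) = Lcoeff (char_pow A m) m m"
proof -
  have \<rho>': "\<rho> \<in> mult_chars" using \<rho> by (auto simp: exact_order_char_def)
  define B where "B i = char_mult (char_pow \<rho> i) A" for i
  have B: "B i \<in> mult_chars" for i using A \<rho>' by (auto simp: B_def)
  have T: "Abs_fps (Lpoint (char_pow A m) m) = (\<Sum>i<m. Abs_fps (Lpoint (B i) 1))"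
    using Lpoint_power[OF A \<rho>] by (intro fps_ext) (simp add: fps_sum_nth B_def)
  have "Abs_fps (Lcoeff (char_pow A m) m) = (\<Prod>i<m. Abs_fps (Lcoeff (B i) 1))"
  proof (rule fps_logderiv_unique)
    show "fps_X * fps_deriv (Abs_fps (Lcoeff (char_pow A m) m)) =
      (\<Sum>i<m. Abs_fps (Lpoint (B i) 1)) * Abs_fps (Lcoeff (char_pow A m) m)"
      using Lfun_logderiv[of "char_pow A m" m] A by (simp add: T)
    show "fps_X * fps_deriv (\<Prod>i<m. Abs_fps (Lcoeff (B i) 1)) =
      (\<Sum>i<m. Abs_fps (Lpoint (B i) 1)) * (\<Prod>i<m. Abs_fps (Lcoeff (B i) 1))"
      using B by (intro fps_logderiv_prod Lfun_logderiv) auto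
    show "Abs_fps (Lcoeff (char_pow A m) m) $ 0 = 1"
      using A by (simp add: Lcoeff_0)
    have "(\<Prod>i<n. Abs_fps (Lcoeff (B i) 1)) $ 0 = 1" for n
      using B by (induction n) (simp_all add: Lcoeff_0)
    then show "(\<Prod>i<m. Abs_fps (Lcoeff (B i) 1)) $ 0 = 1" .
  qed
  also have "\<dots> = (\<Prod>i<m. 1 + fps_const (gauss (B i)) * fps_X)"
    using B by (intro prod.cong refl Lfun_1)
  finally have "Abs_fps (Lcoeff (char_pow A m) m) $ m = (\<Prod>i<m. 1 + fps_const (gauss (B i)) * fps_X) $ m"
    by simp
  then show ?thesis
    by (simp only: fps_prod_linear_nth B_def fps_nth_Abs_fps)
qed

text \<open>The point is that \<open>C\<close> is chosen before \<open>A\<close>: it is a sum of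
  values of \<open>\<theta>\<close> over the polynomials without constant term and involves no
  multiplicative character.\<close>

lemma Lcoeff_power_top:
  assumes m: "1 \<le> m" "of_nat m \<noteq> (0 :: 'a)"
  obtains C where "\<And>A. A \<in> mult_chars \<Longrightarrow> Lcoeff (char_pow A m) m m = C * gauss (char_pow A m) / A (of_nat m) ^ m"
proof
  define Z where "Z = {P \<in> monic_polys m. Polynomial.coeff P 0 = (0 :: 'a)}"
  define v where "v P = (of_ac (power_sum m (ac_roots P)) :: 'a)" for P
  have v: "power_sum m (ac_roots P) = to_ac (v P)" if "P \<in> monic_polys m" for P
  proof -
    have "ac_roots P \<in> stable_msets frob m"
      using bij_betw_ac_roots[OF pp, of m] that unfolding bij_betw_def by blast
    then have "image_mset frob (ac_roots P) = ac_roots P"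
      by (simp add: stable_msets_def)
    from stable_power_sum[OF this, of m] obtain b where "power_sum m (ac_roots P) = to_ac b" .
    then show ?thesis by (simp add: v_def)
  qed
  fix A :: "'a \<Rightarrow> complex" assume A: "A \<in> mult_chars"
  define B where "B = char_pow A m"
  have B: "B \<in> mult_chars" using A by (simp add: B_def)
  have "Lcoeff B m m = (\<Sum>P\<in>monic_polys m. B ((- 1) ^ m * Polynomial.coeff P 0) * \<theta> (v P))"
    unfolding Lcoeff_def sum_stable_msets_frob[OF pp] weight_def v_def
    by (intro sum.cong refl) (simp only: prod_ac_roots of_ac_to_ac)
  \<comment> \<open>A monic polynomial splits uniquely into a part vanishing at 0 and a constant
    \<open>c\<close>; adding \<open>c\<close> changes the power sum by \<open>- m * c\<close>, which
    separates the two variables.\<close>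
  also have "\<dots> = (\<Sum>(P, c)\<in>Z \<times> UNIV. \<theta> (v P) * (B ((- 1) ^ m * c) * \<theta> (- of_nat m * c)))"
  proof (rule sum.reindex_bij_witness[of _ "\<lambda>(P, c). P + [:c:]" "\<lambda>P. (P + [:- Polynomial.coeff P 0:], Polynomial.coeff P 0)"])
    fix P :: "'a poly" assume P: "P \<in> monic_polys m"
    define c where "c = Polynomial.coeff P 0"
    have Q: "P + [:- c:] \<in> monic_polys m"
      using P m by (intro monic_polys_add) auto
    show "(P + [:- Polynomial.coeff P 0:], Polynomial.coeff P 0) \<in> Z \<times> UNIV"
      using Q by (simp add: Z_def c_def)
    show "(case (P + [:- Polynomial.coeff P 0:], Polynomial.coeff P 0) of (P, c) \<Rightarrow> P + [:c:]) = P"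
      by (simp add: add.assoc)
    have "power_sum m (ac_roots (P + [:- c:])) = to_ac (v P + of_nat m * c)"
      using power_sum_ac_roots_add_const[OF P m(1), of "- c"] v[OF P] by simp
    then have "v (P + [:- c:]) = v P + of_nat m * c"
      unfolding v_def[of "P + [:- c:]"] by (simp only: of_ac_to_ac)
    then have "\<theta> (v (P + [:- c:])) * \<theta> (- of_nat m * c) = \<theta> (v P)"
      by (simp flip: add)
    then show "(case (P + [:- Polynomial.coeff P 0:], Polynomial.coeff P 0) of
          (P, c) \<Rightarrow> \<theta> (v P) * (B ((- 1) ^ m * c) * \<theta> (- of_nat m * c))) =
        B ((- 1) ^ m * Polynomial.coeff P 0) * \<theta> (v P)"
      by (simp add: mult_ac flip: c_def)
  next
    fix b assume "b \<in> Z \<times> (UNIV :: 'a set)"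
    then obtain P c where b: "b = (P, c)" "P \<in> monic_polys m" "Polynomial.coeff P 0 = 0"
      by (auto simp: Z_def)
    have "P + [:c:] \<in> monic_polys m"
      using b m by (intro monic_polys_add) auto
    then show "(case b of (P, c) \<Rightarrow> P + [:c:]) \<in> monic_polys m"
      using b by simp
    show "((case b of (P, c) \<Rightarrow> P + [:c:]) + [:- Polynomial.coeff (case b of (P, c) \<Rightarrow> P + [:c:]) 0:],
        Polynomial.coeff (case b of (P, c) \<Rightarrow> P + [:c:]) 0) = b"
      using b by (simp add: add.assoc)
  qed
  also have "\<dots> = (\<Sum>P\<in>Z. \<theta> (v P)) * (\<Sum>c\<in>UNIV. B ((- 1) ^ m * c) * \<theta> (- of_nat m * c))"
    by (simp add: sum_product sum.cartesian_product)
  also have "(\<Sum>c\<in>UNIV. B ((- 1) ^ m * c) * \<theta> (- of_nat m * c)) =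
      B ((- 1) ^ m) * (\<Sum>c\<in>UNIV. B c * \<theta> (- of_nat m * c))"
    by (simp only: mult_char_mult[OF B] sum_distrib_left mult.assoc)
  also have "(\<Sum>c\<in>UNIV. B c * \<theta> (- of_nat m * c)) = gauss B / B (- of_nat m)"
    using m by (intro gauss_scale B) auto
  also have "B (- of_nat m) = B (- 1) * B (of_nat m)"
    using mult_char_mult[OF B, of "- 1" "of_nat m"] by simp
  \<comment> \<open>\<open>m\<close> and \<open>m * m\<close> have the same parity, and
    \<open>B\<close> is an m-th power; so the sign from the constant coefficient cancels the one
    from the scaling by \<open>- m\<close>.\<close>
  also have "B (- 1) = B ((- 1) ^ m)"
  proof -
    have "(- 1 :: 'a) ^ m = ((- 1) ^ m) ^ m" by (cases "even m") simp_all
    then have "A (- 1) ^ m = (A (- 1) ^ m) ^ m"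
      by (metis mult_char_power[OF A])
    then show ?thesis
      using A by (simp add: B_def char_pow_def mult_char_power)
  qed
  also have "B (of_nat m) = A (of_nat m) ^ m"
    using m by (simp add: B_def char_pow_def)
  finally show "Lcoeff (char_pow A m) m m = (\<Sum>P\<in>Z. \<theta> (v P)) * gauss (char_pow A m) / A (of_nat m) ^ m"
    using mult_char_nonzero[OF B, of "(- 1) ^ m"] by (simp add: B_def)
qed

text \<open>At the trivial character the factor \<open>i = 0\<close> on the left and the Gauss sum
  on the right are both -1. This identifies \<open>C\<close> as the product over the nontrivial
  powers of \<rho>.\<close>

theorem hasse_davenport:
  assumes A: "A \<in> mult_chars" and \<rho>: "exact_order_char \<rho> m" and m: "of_nat m \<noteq> (0 :: 'a)"
  shows "(\<Prod>i<m. gauss (char_mult (char_pow \<rho> i) A)) =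
    (\<Prod>i=1..<m. gauss (char_pow \<rho> i)) * gauss (char_pow A m) / A (of_nat m) ^ m"
proof -
  have m1: "1 \<le> m" and \<rho>': "\<rho> \<in> mult_chars" using \<rho> by (auto simp: exact_order_char_def)
  obtain C where C: "\<And>A. A \<in> mult_chars \<Longrightarrow> Lcoeff (char_pow A m) m m = C * gauss (char_pow A m) / A (of_nat m) ^ m"
    using Lcoeff_power_top[OF m1 m] by blast
  have triv: "char_pow triv_char m = (triv_char :: 'a \<Rightarrow> complex)"
    by (auto simp: char_pow_def triv_char_def fun_eq_iff)
  have "char_mult (char_pow \<rho> i) triv_char = char_pow \<rho> i" for i
    by (auto simp: char_pow_def triv_char_def char_mult_def fun_eq_iff)
  then have "(\<Prod>i<m. gauss (char_pow \<rho> i)) = C * gauss triv_char"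
    using prod_gauss_eq_Lcoeff[OF triv_char_in_mult_chars \<rho>] C[OF triv_char_in_mult_chars] m
    by (simp add: triv) (simp add: triv_char_def)
  moreover have "(\<Prod>i<m. gauss (char_pow \<rho> i)) = gauss (char_pow \<rho> 0) * (\<Prod>i=1..<m. gauss (char_pow \<rho> i))"
    using m1 by (simp add: lessThan_atLeast0 prod.atLeast_Suc_lessThan)
  moreover have "char_pow \<rho> 0 = triv_char"
    by (auto simp: char_pow_def triv_char_def fun_eq_iff)
  ultimately have "C = (\<Prod>i=1..<m. gauss (char_pow \<rho> i))"
    by (simp add: gauss_triv_char)
  then show ?thesis
    using prod_gauss_eq_Lcoeff[OF A \<rho>] C[OF A] by simp
qed

end

subsection \<open>Gauss and Jacobi sums indexed by powers of a generator\<close>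

lemma power_int_eq_1_iff: "z powi u = 1 \<longleftrightarrow> z ^ nat \<bar>u\<bar> = 1" for z :: complex
  by (auto simp: power_int_def power_inverse)

text \<open>A character \<open>\<eta>\<close> with \<open>\<eta> g\<close> a primitive root of unity
  of order q - 1 is built by discrete logarithm. Being a power of \<open>T\<close>, it forces
  \<open>T g\<close> to have full order.\<close>

lemma char_generator_injective:
  fixes T :: "'a::{field,finite} \<Rightarrow> complex"
  assumes "char_generator T" "primitive_element g"
  shows "T g ^ j = 1 \<longleftrightarrow> (card (UNIV :: 'a set) - 1) dvd j"
proof -
  let ?n = "card (UNIV :: 'a set) - 1"
  note g0 = primitive_elementD(1)[OF assms(2)] and gen = primitive_elementD(2)[OF assms(2)]
    and order = primitive_elementD(3)[OF assms(2)]
  have n: "0 < ?n" using finite_field_card_ge_2[where 'a='a] by simp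
  have T: "T \<in> mult_chars" using assms(1) by (simp add: char_generator_def)
  define \<omega> where "\<omega> = cis (2 * pi / real ?n)"
  have \<omega>: "\<omega> ^ i = 1 \<longleftrightarrow> ?n dvd i" for i
    unfolding \<omega>_def by (rule cis_root_power_eq_1_iff[OF n])
  have \<omega>_mod: "\<omega> ^ i = \<omega> ^ (i mod ?n)" for i
    using \<omega>[of ?n] by (intro power_mod_period) simp
  define lg where "lg x = (SOME i. x = g ^ i)" for x
  have lg: "x = g ^ lg x" if "x \<noteq> 0" for x
    unfolding lg_def using gen[OF that] by (rule someI_ex)
  define \<eta> where "\<eta> x = (if x = 0 then 0 else \<omega> ^ lg x)" for x
  have "\<omega> \<noteq> 0" unfolding \<omega>_def by simp
  have "\<eta> (x * y) = \<eta> x * \<eta> y" for x y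
  proof (cases "x = 0 \<or> y = 0")
    case False
    then have "g ^ lg (x * y) = g ^ (lg x + lg y)"
      using lg[of "x * y"] lg[of x] lg[of y] by (simp add: power_add)
    then have "lg (x * y) mod ?n = (lg x + lg y) mod ?n"
      using order by blast
    then have "\<omega> ^ lg (x * y) = \<omega> ^ (lg x + lg y)"
      using \<omega>_mod by metis
    with False show ?thesis by (simp add: \<eta>_def power_add)
  qed (auto simp: \<eta>_def)
  then have "\<eta> \<in> mult_chars"
    using \<open>\<omega> \<noteq> 0\<close> by (auto simp: mult_chars_def \<eta>_def)
  then obtain k where k: "\<eta> = char_pow T k"
    using assms(1) by (auto simp: char_generator_def)
  have "g ^ lg g = g ^ 1" using lg[OF g0] by simp
  then have "lg g mod ?n = 1 mod ?n" using order by blast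
  then have "\<omega> ^ lg g = \<omega> ^ 1" using \<omega>_mod by metis
  then have Tg: "T g ^ k = \<omega>"
    using fun_cong[OF k, of g] g0 by (simp add: \<eta>_def char_pow_def)
  show ?thesis
  proof
    assume "T g ^ j = 1"
    then have "\<omega> ^ j = 1"
      unfolding Tg[symmetric] by (metis mult.commute power_mult power_one)
    then show "?n dvd j" using \<omega> by blast
  next
    assume "?n dvd j"
    then have "g ^ j = g ^ 0" unfolding order by (simp add: dvd_eq_mod_eq_0)
    then show "T g ^ j = 1"
      using mult_char_power[OF T, of g j] mult_char_1[OF T] by simp
  qed
qed

locale gauss_setup = additive_char \<theta> for \<theta> :: "'a::{field,finite} \<Rightarrow> complex" +
  fixes T :: "'a \<Rightarrow> complex" and q :: nat and n :: int
  assumes gen: "char_generator T"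
    and q_def: "q = card (UNIV :: 'a set)"
    and n_def: "n = int q - 1"
begin

text \<open>Integer exponents give inverses and differences of characters directly, and equality
  becomes divisibility by \<open>n = q - 1\<close>. Zero is treated apart because
  \<open>0 powi 0 = 1\<close>.\<close>

definition tc :: "int \<Rightarrow> 'a \<Rightarrow> complex" where
  "tc k x = (if x = 0 then 0 else T x powi k)"

lemma q_ge_2: "2 \<le> q"
  unfolding q_def by (rule finite_field_card_ge_2)

lemma int_q_minus_1: "int (q - 1) = n"
  using q_ge_2 by (simp add: n_def)

lemmas power_q_minus_1 = finite_field_power_card_minus_1[where 'a='a, folded q_def]

lemma T_mult_char: "T \<in> mult_chars"
  using gen by (simp add: char_generator_def)

lemma T_nonzero: "x \<noteq> 0 \<Longrightarrow> T x \<noteq> 0"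
  using T_mult_char by (rule mult_char_nonzero)

lemma T_order: "x \<noteq> 0 \<Longrightarrow> T x ^ (q - 1) = 1"
  using power_q_minus_1[of x] mult_char_power[OF T_mult_char, of x "q - 1"] mult_char_1[OF T_mult_char]
  by simp

text \<open>Faithfulness of the generator: it maps a primitive element to a root of unity of the
  same order.\<close>

lemma T_power_eq_1_iff:
  assumes "x \<noteq> 0"
  shows "T x ^ k = 1 \<longleftrightarrow> x ^ k = 1"
proof -
  obtain g :: 'a where prim: "primitive_element g" using primitive_element_exists by blast
  note g = primitive_elementD[OF prim, folded q_def]
  obtain i where i: "x = g ^ i" using g(2)[OF assms] by blast
  have "T x ^ k = T g ^ (i * k)"
    by (simp add: i mult_char_power[OF T_mult_char] power_mult)
  then have "T x ^ k = 1 \<longleftrightarrow> (q - 1) dvd i * k"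
    using char_generator_injective[OF gen prim, folded q_def] by simp
  also have "\<dots> \<longleftrightarrow> g ^ (i * k) = g ^ 0"
    using g(3)[of "i * k" 0] by (simp add: dvd_eq_mod_eq_0)
  finally show ?thesis by (simp add: i power_mult)
qed

lemma T_eq_1_iff: "x \<noteq> 0 \<Longrightarrow> T x = 1 \<longleftrightarrow> x = 1"
  using T_power_eq_1_iff[of x 1] by simp

lemma tc_mult_char [simp, intro]: "tc k \<in> mult_chars"
  using T_nonzero by (auto simp: mult_chars_def tc_def mult_char_mult[OF T_mult_char] power_int_mult_distrib)

lemma tc_at_0 [simp]: "tc k 0 = 0"
  by (simp add: tc_def)

lemma tc_at_1 [simp]: "tc k 1 = 1"
  by (simp add: mult_char_1)

lemma tc_nonzero: "x \<noteq> 0 \<Longrightarrow> tc k x \<noteq> 0"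
  by (rule mult_char_nonzero) auto

lemma tc_mult: "tc k (x * y) = tc k x * tc k y"
  by (rule mult_char_mult) auto

lemma tc_power: "tc k (x ^ m) = tc k x ^ m"
  by (rule mult_char_power) auto

lemma tc_divide: "tc k (x / y) = tc k x / tc k y"
  by (rule mult_char_divide) auto

lemma tc_add: "tc (i + j) x = tc i x * tc j x"
  using T_nonzero[of x] by (simp add: tc_def power_int_add)

lemma tc_minus: "tc (- i) x = inverse (tc i x)"
  by (simp add: tc_def power_int_minus)

lemma tc_times_nat: "x \<noteq> 0 \<Longrightarrow> tc (k * int m) x = tc k x ^ m"
  by (simp add: tc_def power_int_mult)

lemma char_mult_tc: "char_mult (tc i) (tc j) = tc (i + j)"
  by (rule ext) (simp add: char_mult_def tc_add)

lemma char_inv_tc: "char_inv (tc i) = tc (- i)"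
  by (rule ext) (simp add: char_inv_def tc_def power_int_minus divide_inverse)

lemma char_pow_tc: "char_pow (tc i) m = tc (i * int m)"
  by (rule ext) (simp add: char_pow_def tc_times_nat)

lemma char_pow_T: "char_pow T m = tc (int m)"
  by (rule ext) (simp add: char_pow_def tc_def)

lemma triv_char_tc: "triv_char = tc 0"
  by (rule ext) (simp add: triv_char_def tc_def)

lemma tc_n_times: "tc (n * i) = tc 0"
proof (rule ext)
  fix x
  have "T x powi n = 1" if "x \<noteq> 0"
    using T_order[OF that] unfolding int_q_minus_1[symmetric] by simp
  then show "tc (n * i) x = tc 0 x"
    by (simp add: tc_def power_int_mult)
qed

lemma tc_cong:
  assumes "n dvd i - j"
  shows "tc i = tc j"
proof (rule ext)
  fix x
  obtain l where l: "i = n * l + j" using assms by (metis add.commute diff_add_cancel dvdE)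
  show "tc i x = tc j x"
    unfolding l tc_add tc_n_times by (simp add: tc_def)
qed

lemma tc_eq_triv_iff: "tc u = tc 0 \<longleftrightarrow> n dvd u"
proof
  obtain g :: 'a where prim: "primitive_element g" using primitive_element_exists by blast
  note g = primitive_elementD[OF prim, folded q_def]
  assume "tc u = tc 0"
  then have "tc u g = tc 0 g" by simp
  then have "T g powi u = 1" using g(1) by (simp add: tc_def)
  then have "T g ^ nat \<bar>u\<bar> = 1" by (simp add: power_int_eq_1_iff)
  then have "(q - 1) dvd nat \<bar>u\<bar>" using char_generator_injective[OF gen prim, folded q_def] by simp
  then show "n dvd u" unfolding int_q_minus_1[symmetric] by (metis dvd_abs_iff int_dvd_int_iff int_nat_eq abs_ge_zero)
next
  assume "n dvd u"
  then show "tc u = tc 0" by (intro tc_cong) simp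
qed

lemma tc_eq_iff: "tc i = tc j \<longleftrightarrow> n dvd i - j"
proof
  assume "tc i = tc j"
  then have "tc (i - j) = tc 0"
    using T_nonzero by (auto simp: fun_eq_iff tc_def power_int_diff split: if_splits)
  then show "n dvd i - j" by (simp add: tc_eq_triv_iff)
qed (rule tc_cong)

lemma sum_mult_chars: "(\<Sum>\<chi>\<in>mult_chars. f \<chi>) = (\<Sum>k<q - 1. f (tc (int k)))"
proof (rule sum.reindex_bij_betw[symmetric])
  have "inj_on (\<lambda>k. tc (int k)) {..<q - 1}"
  proof (rule inj_onI)
    fix i j assume ij: "i \<in> {..<q - 1}" "j \<in> {..<q - 1}" "tc (int i) = tc (int j)"
    then have "[int i = int j] (mod int (q - 1))"
      unfolding int_q_minus_1 by (simp add: tc_eq_iff cong_iff_dvd_diff)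
    then show "i = j"
      using ij by (simp add: cong_int_iff cong_less_modulus_unique_nat)
  qed
  moreover have "mult_chars \<subseteq> (\<lambda>k. tc (int k)) ` {..<q - 1}"
  proof
    fix \<chi> :: "'a \<Rightarrow> complex" assume "\<chi> \<in> mult_chars"
    then obtain k where k: "\<chi> = char_pow T k" using gen by (auto simp: char_generator_def)
    have "int (q - 1) dvd int k - int (k mod (q - 1))"
      by (simp add: zmod_int mod_0_imp_dvd flip: mod_eq_dvd_iff)
    then have "\<chi> = tc (int (k mod (q - 1)))"
      unfolding k char_pow_T int_q_minus_1 by (rule tc_cong)
    then show "\<chi> \<in> (\<lambda>k. tc (int k)) ` {..<q - 1}"
      using q_ge_2 by (intro image_eqI[of _ _ "k mod (q - 1)"]) auto
  qed
  ultimately show "bij_betw (\<lambda>k. tc (int k)) {..<q - 1} mult_chars"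
    by (auto simp: bij_betw_def)
qed

section \<open>Orthogonality relations\<close>

lemma sum_tc_index: "(\<Sum>k<q - 1. tc (int k) x) = (if x = 1 then of_nat (q - 1) else 0)"
proof (cases "x = 0 \<or> x = 1")
  case False
  then have "T x \<noteq> 1" by (simp add: T_eq_1_iff)
  then show ?thesis
    using False T_order[of x] by (simp add: tc_def geometric_sum)
qed auto

lemma sum_tc_arg:
  assumes "\<not> n dvd u"
  shows "(\<Sum>x\<in>UNIV. tc u x) = 0"
proof -
  have "tc u \<noteq> tc 0" using assms tc_eq_triv_iff by simp
  then obtain c where c: "c \<noteq> 0" "tc u c \<noteq> 1"
    by (auto simp: fun_eq_iff tc_def split: if_splits)
  have "(\<Sum>x\<in>UNIV. tc u x) = (\<Sum>x\<in>UNIV. tc u (c * x))"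
    by (rule sum.reindex_bij_witness[of _ "\<lambda>x. c * x" "\<lambda>x. x / c"]) (use c in auto)
  also have "\<dots> = tc u c * (\<Sum>x\<in>UNIV. tc u x)"
    by (simp add: tc_mult sum_distrib_left)
  finally show ?thesis using c by simp
qed

text \<open>The absolute value admits \<open>u\<close> and \<open>- u\<close> alike: inverse
  characters have the same order and kernel.\<close>

lemma exact_order_char_tc:
  assumes "int m * \<bar>u\<bar> = n"
  shows "exact_order_char (tc u) m"
proof -
  have "int (m * nat \<bar>u\<bar>) = int (q - 1)" unfolding int_q_minus_1 using assms by simp
  then have mu: "m * nat \<bar>u\<bar> = q - 1" by (simp only: of_nat_eq_iff)
  then have m: "1 \<le> m" using q_ge_2 by (cases m) auto
  have "nat \<bar>u\<bar> = (q - 1) div m" using mu m by (metis nonzero_mult_div_cancel_left not_one_le_zero)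
  moreover have "tc u x ^ m = 1" if "x \<noteq> 0" for x
  proof -
    have "n dvd u * int m" using assms by (metis abs_dvd_iff abs_mult abs_of_nat dvd_refl mult.commute)
    then have "tc (u * int m) = tc 0" by (simp add: tc_eq_triv_iff)
    then show ?thesis using that tc_times_nat[OF that, of u m] by (simp add: tc_def)
  qed
  moreover have "tc u x = 1 \<longleftrightarrow> x ^ nat \<bar>u\<bar> = 1" if "x \<noteq> 0" for x
    using that by (simp add: tc_def power_int_eq_1_iff T_power_eq_1_iff)
  moreover have "m dvd q - 1" using mu by (metis dvd_triv_left)
  ultimately show ?thesis
    using m unfolding exact_order_char_def q_def[symmetric] by auto
qed

lemma minus_1_neq_1:
  assumes "odd q"
  shows "(- 1 :: 'a) \<noteq> 1"
proof -
  have "of_nat 2 \<noteq> (0 :: 'a)"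
  proof
    assume "of_nat 2 = (0 :: 'a)"
    then have "CHAR('a) dvd 2" by (simp only: of_nat_eq_0_iff_char_dvd)
    then have "CHAR('a) = 2"
      using prime_CHAR_finite_field[where 'a='a] by (metis primes_dvd_imp_eq two_is_prime_nat)
    then show False using CHAR_dvd_CARD[where 'a='a] assms by (simp add: q_def)
  qed
  then show ?thesis by (metis add.left_inverse of_nat_numeral one_add_one)
qed

text \<open>\<open>T (- 1)\<close> is a square root of 1, and by faithfulness it is not 1
  itself.\<close>

lemma tc_minus_1:
  assumes "odd q"
  shows "tc k (- 1) = (if even k then 1 else - 1)"
proof -
  have "T (- 1) \<noteq> 1" using minus_1_neq_1[OF assms] by (simp add: T_eq_1_iff)
  moreover have "T (- 1) * T (- 1) = 1"
    using mult_char_mult[OF T_mult_char, of "- 1" "- 1"] mult_char_1[OF T_mult_char] by simp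
  ultimately have "T (- 1) = - 1" by (metis square_eq_1_iff)
  then show ?thesis by (simp add: tc_def power_int_minus_left)
qed

text \<open>Euler's criterion: away from 0 both sides are \<plusminus>1, and both equal 1 exactly
  where \<open>x ^ h' = 1\<close>.\<close>

lemma quad_char_tc:
  assumes "2 * h = n"
  shows "quad_char = tc h"
proof (rule ext)
  fix x :: 'a
  have h: "exact_order_char (tc h) 2"
    using assms q_ge_2 n_def by (intro exact_order_char_tc) auto
  obtain g :: 'a where prim: "primitive_element g" using primitive_element_exists by blast
  note g = primitive_elementD[OF prim, folded q_def]
  obtain h' where h': "q - 1 = 2 * h'" "0 < h'"
    using assms q_ge_2 by (metis int_q_minus_1 even_of_nat_iff dvdE dvd_triv_left Suc_1 diff_is_0_eq gr0I mult_0_right not_less_eq_eq One_nat_def)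
  have sq: "(\<exists>y. y ^ 2 = x) \<longleftrightarrow> x ^ h' = 1" if x0: "x \<noteq> 0"
  proof
    assume "\<exists>y. y ^ 2 = x"
    then obtain y where y: "x = y ^ 2" by blast
    then have "x ^ h' = y ^ (q - 1)" by (simp only: y h'(1) power_mult)
    then show "x ^ h' = 1" using y x0 power_q_minus_1[of y] by auto
  next
    assume "x ^ h' = 1"
    obtain i where i: "x = g ^ i" using g(2)[OF x0] by blast
    then have "g ^ (i * h') = g ^ 0" using \<open>x ^ h' = 1\<close> by (simp add: power_mult)
    then have "2 * h' dvd i * h'" using g(3)[of "i * h'" 0] h' by (simp add: dvd_eq_mod_eq_0)
    then have "even i" using h' by simp
    then show "\<exists>y. y ^ 2 = x" using i by (metis dvdE mult.commute power_mult)
  qed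
  show "quad_char x = tc h x"
  proof (cases "x = 0")
    case False
    have "(q - 1) div 2 = h'" using h' by simp
    then have "tc h x ^ 2 = 1" "tc h x = 1 \<longleftrightarrow> x ^ h' = 1"
      using h False unfolding exact_order_char_def q_def[symmetric] by auto
    then show ?thesis
      using sq[OF False] False by (auto simp: quad_char_def power2_eq_1_iff)
  qed (simp add: quad_char_def)
qed

section \<open>Gauss sums, the reflection formula and Jacobi sums\<close>

definition G :: "int \<Rightarrow> complex" where "G k = gauss (tc k)"

lemma G_cong: "n dvd i - j \<Longrightarrow> G i = G j"
  unfolding G_def using tc_cong by metis

lemma G_scale: "c \<noteq> 0 \<Longrightarrow> (\<Sum>x\<in>UNIV. tc k x * \<theta> (c * x)) = G k * tc (- k) c"
  unfolding G_def by (subst gauss_scale) (auto simp: tc_minus divide_inverse)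

lemma sum_theta_scale: "(\<Sum>x\<in>UNIV. \<theta> (c * x)) = (if c = 0 then of_nat q else 0)"
proof (cases "c = 0")
  case False
  have "(\<Sum>x\<in>UNIV. \<theta> (c * x)) = (\<Sum>x\<in>UNIV. \<theta> x)"
    by (rule sum.reindex_bij_witness[of _ "\<lambda>x. x / c" "\<lambda>x. c * x"]) (use False in auto)
  then show ?thesis using False sum_theta by simp
qed (simp add: q_def)

lemma G_times_G_minus:
  assumes "\<not> n dvd k"
  shows "G k * G (- k) = tc k (- 1) * of_nat q"
proof -
  have "G k * G (- k) = (\<Sum>y\<in>UNIV. tc (- k) y * \<theta> y * G k)"
    by (simp add: G_def[of "- k"] gauss_def sum_distrib_left mult_ac)
  also have "\<dots> = (\<Sum>y\<in>UNIV - {0}. tc (- k) y * \<theta> y * G k)"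
    by (rule sum.mono_neutral_right) auto
  \<comment> \<open>Scaling absorbs \<open>tc (- k) y\<close> into the inner sum. After the exchange
    of sums, orthogonality keeps only \<open>u = - 1\<close>; the missing \<open>y = 0\<close> costs
    the full sum of \<open>tc k\<close>, which is zero.\<close>
  also have "\<dots> = (\<Sum>y\<in>UNIV - {0}. \<Sum>u\<in>UNIV. tc k u * \<theta> (y * (u + 1)))"
  proof (rule sum.cong[OF refl])
    fix y :: 'a assume "y \<in> UNIV - {0}"
    then have y: "y \<noteq> 0" by simp
    have "tc (- k) y * \<theta> y * G k = \<theta> y * (\<Sum>u\<in>UNIV. tc k u * \<theta> (y * u))"
      unfolding G_scale[OF y] by (simp add: mult_ac)
    also have "\<dots> = (\<Sum>u\<in>UNIV. tc k u * \<theta> (y * (u + 1)))"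
      by (simp add: sum_distrib_left distrib_left add mult_ac)
    finally show "tc (- k) y * \<theta> y * G k = (\<Sum>u\<in>UNIV. tc k u * \<theta> (y * (u + 1)))" .
  qed
  also have "\<dots> = (\<Sum>u\<in>UNIV. \<Sum>y\<in>UNIV - {0}. tc k u * \<theta> (y * (u + 1)))"
    by (rule sum.swap)
  also have "\<dots> = (\<Sum>u\<in>UNIV. tc k u * ((if u = - 1 then of_nat q else 0) - 1))"
  proof (rule sum.cong[OF refl])
    fix u :: 'a
    have "(\<Sum>y\<in>UNIV - {0}. \<theta> (y * (u + 1))) = (\<Sum>y\<in>UNIV. \<theta> ((u + 1) * y)) - 1"
      by (subst sum_diff1) (auto simp: mult.commute)
    also have "\<dots> = (if u = - 1 then of_nat q else 0) - 1"
      by (simp add: sum_theta_scale eq_neg_iff_add_eq_0)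
    finally show "(\<Sum>y\<in>UNIV - {0}. tc k u * \<theta> (y * (u + 1))) = tc k u * ((if u = - 1 then of_nat q else 0) - 1)"
      by (simp flip: sum_distrib_left)
  qed
  also have "\<dots> = (\<Sum>u\<in>UNIV. (if u = - 1 then tc k u * of_nat q else 0) - tc k u)"
    by (intro sum.cong refl) (simp add: right_diff_distrib)
  also have "\<dots> = (\<Sum>u\<in>UNIV. if u = - 1 then tc k u * of_nat q else 0) - (\<Sum>u\<in>UNIV. tc k u)"
    by (rule sum_subtractf)
  also have "\<dots> = tc k (- 1) * of_nat q"
    using sum_tc_arg[OF assms] by simp
  finally show ?thesis .
qed

lemma G_nonzero: "G k \<noteq> 0"
proof (cases "n dvd k")
  case True
  then have "G k = gauss triv_char"
    unfolding triv_char_tc G_def using tc_eq_triv_iff by metis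
  then show ?thesis by (simp add: gauss_triv_char)
next
  case False
  have "tc k (- 1) * of_nat q \<noteq> 0"
    using tc_nonzero[of "- 1" k] q_ge_2 by auto
  then show ?thesis using G_times_G_minus[OF False] by auto
qed

text \<open>The product of Gauss sums is sliced by \<open>s = x + y\<close>: the slice
  \<open>s = 0\<close> vanishes because \<open>tc (i + j)\<close> is nontrivial, and the others
  scale to the Jacobi sum. Trivial \<open>i\<close> or \<open>j\<close> are covered, as the series
  requires, since its characters run through the whole group.\<close>

lemma jacobi_sum:
  assumes "\<not> n dvd i + j"
  shows "(\<Sum>x\<in>UNIV. tc i x * tc j (1 - x)) = G i * G j / G (i + j)"
proof -
  let ?J = "\<Sum>x\<in>UNIV. tc i x * tc j (1 - x)"
  have "G i * G j = (\<Sum>x\<in>UNIV. \<Sum>y\<in>UNIV. tc i x * tc j y * \<theta> (x + y))"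
    by (simp add: G_def gauss_def sum_product add mult_ac)
  also have "\<dots> = (\<Sum>x\<in>UNIV. \<Sum>s\<in>UNIV. tc i x * tc j (s - x) * \<theta> s)"
  proof (rule sum.cong[OF refl])
    fix x :: 'a
    show "(\<Sum>y\<in>UNIV. tc i x * tc j y * \<theta> (x + y)) = (\<Sum>s\<in>UNIV. tc i x * tc j (s - x) * \<theta> s)"
      by (rule sum.reindex_bij_witness[of _ "\<lambda>s. s - x" "\<lambda>y. x + y"]) auto
  qed
  also have "\<dots> = (\<Sum>s\<in>UNIV. \<Sum>x\<in>UNIV. tc i x * tc j (s - x) * \<theta> s)"
    by (rule sum.swap)
  also have "\<dots> = (\<Sum>s\<in>UNIV. tc (i + j) s * \<theta> s * ?J)"
  proof (rule sum.cong[OF refl])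
    fix s :: 'a
    show "(\<Sum>x\<in>UNIV. tc i x * tc j (s - x) * \<theta> s) = tc (i + j) s * \<theta> s * ?J"
    proof (cases "s = 0")
      case True
      have "(\<Sum>x\<in>UNIV. tc i x * tc j (s - x) * \<theta> s) = tc j (- 1) * (\<Sum>x\<in>UNIV. tc (i + j) x)"
        unfolding sum_distrib_left
        by (intro sum.cong refl) (use True in \<open>simp add: tc_add mult_ac flip: tc_mult\<close>)
      then show ?thesis using True sum_tc_arg[OF assms] by simp
    next
      case False
      have "(\<Sum>x\<in>UNIV. tc i x * tc j (s - x) * \<theta> s) = (\<Sum>x\<in>UNIV. tc i (s * x) * tc j (s - s * x) * \<theta> s)"
        by (rule sum.reindex_bij_witness[of _ "\<lambda>x. s * x" "\<lambda>x. x / s"]) (use False in auto)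
      also have "\<dots> = (\<Sum>x\<in>UNIV. tc (i + j) s * \<theta> s * (tc i x * tc j (1 - x)))"
      proof (rule sum.cong[OF refl])
        fix x :: 'a
        have "s - s * x = s * (1 - x)" by (simp add: algebra_simps)
        then show "tc i (s * x) * tc j (s - s * x) * \<theta> s = tc (i + j) s * \<theta> s * (tc i x * tc j (1 - x))"
          by (simp add: tc_mult tc_add)
      qed
      finally show ?thesis by (simp add: sum_distrib_left)
    qed
  qed
  also have "\<dots> = G (i + j) * ?J"
    by (simp add: G_def gauss_def sum_distrib_right)
  finally show ?thesis using G_nonzero[of "i + j"] by (simp add: field_simps)
qed

lemma char_binom_tc:
  assumes "\<not> n dvd u - v"
  shows "char_binom (tc u) (tc v) = tc v (- 1) / of_nat q * (G u * G (- v) / G (u - v))"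
  unfolding char_binom_def char_inv_tc q_def[symmetric]
  using jacobi_sum[of u "- v"] assms by simp

end

subsection \<open>Character sum expansion of the point count\<close>

text \<open>The reflection \<open>j \<mapsto> 2 * e - j\<close>, whose fixed point \<open>e\<close>
  is the index left out; it will pair each Gauss sum with that of the inverse character.\<close>

lemma prod_pair_even:
  fixes f :: "nat \<Rightarrow> complex"
  shows "(\<Prod>j\<in>{1..<2 * e} - {e}. f j) = (\<Prod>j=1..<e. f j * f (2 * e - j))"
proof -
  have "{1..<2 * e} - {e} = {1..<e} \<union> {e + 1..<2 * e}" by auto
  then have "(\<Prod>j\<in>{1..<2 * e} - {e}. f j) = (\<Prod>j=1..<e. f j) * (\<Prod>j=e + 1..<2 * e. f j)"
    by (simp add: prod.union_disjoint)
  also have "(\<Prod>j=e + 1..<2 * e. f j) = (\<Prod>j=1..<e. f (2 * e - j))"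
    by (rule prod.reindex_bij_witness[of _ "\<lambda>j. 2 * e - j" "\<lambda>j. 2 * e - j"]) auto
  finally show ?thesis by (simp add: prod.distrib)
qed

text \<open>Here the reflection \<open>j \<mapsto> 2 * e - 1 - j\<close> has no fixed point.\<close>

lemma prod_pair_odd:
  fixes f :: "nat \<Rightarrow> complex"
  shows "(\<Prod>j=1..<2 * e - 1. f j) = (\<Prod>j=1..<e. f j * f (2 * e - 1 - j))"
proof (cases "e = 0")
  case False
  then have "{1..<2 * e - 1} = {1..<e} \<union> {e..<2 * e - 1}" by auto
  then have "(\<Prod>j=1..<2 * e - 1. f j) = (\<Prod>j=1..<e. f j) * (\<Prod>j=e..<2 * e - 1. f j)"
    by (simp add: prod.union_disjoint)
  also have "(\<Prod>j=e..<2 * e - 1. f j) = (\<Prod>j=1..<e. f (2 * e - 1 - j))"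
    by (rule prod.reindex_bij_witness[of _ "\<lambda>j. 2 * e - 1 - j" "\<lambda>j. 2 * e - 1 - j"]) auto
  finally show ?thesis by (simp add: prod.distrib)
qed simp

context gauss_setup
begin

lemma card_square_roots:
  assumes "odd q"
  shows "of_nat (card {y :: 'a. y ^ 2 = z}) = 1 + quad_char z"
proof (cases "\<exists>y. y ^ 2 = z")
  case True
  then obtain y where y: "y ^ 2 = z" by blast
  have eq: "{w. w ^ 2 = z} = {y, - y}"
    using y by (auto simp: power2_eq_iff)
  show ?thesis
  proof (cases "z = 0")
    case False
    then have "y \<noteq> 0" using y by auto
    then have "y \<noteq> - y"
      using minus_1_neq_1[OF assms] by (metis mult_minus1 mult_cancel_right2 )
    then show ?thesis using True False by (simp add: eq quad_char_def)
  qed (use y eq in \<open>simp add: quad_char_def\<close>)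
next
  case False
  then have "{y. y ^ 2 = z} = {}" "z \<noteq> 0" by (auto simp: zero_power2 intro: exI[of _ 0])
  then show ?thesis using False by (simp add: quad_char_def)
qed

text \<open>\<open>x = 0\<close> is split off because the substitution used later divides by a power
  of \<open>x\<close>; for the curve it yields the term \<phi>(b).\<close>

lemma card_double_cover:
  fixes f :: "'a \<Rightarrow> 'a"
  assumes "odd q"
  shows "of_nat (card {(x, y). y ^ 2 = f x}) = of_nat q + quad_char (f 0) + (\<Sum>x\<in>UNIV - {0}. quad_char (f x))"
proof -
  have "{(x, y). y ^ 2 = f x} = (SIGMA x:UNIV. {y. y ^ 2 = f x})" by auto
  then have "card {(x, y). y ^ 2 = f x} = (\<Sum>x\<in>UNIV. card {y. y ^ 2 = f x})"
    by (simp add: card_SigmaI)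
  then have "of_nat (card {(x, y). y ^ 2 = f x}) = (\<Sum>x\<in>UNIV. 1 + quad_char (f x))"
    by (simp add: card_square_roots[OF assms])
  also have "\<dots> = of_nat q + (\<Sum>x\<in>UNIV. quad_char (f x))"
    by (simp add: sum.distrib q_def)
  also have "(\<Sum>x\<in>UNIV. quad_char (f x)) = quad_char (f 0) + (\<Sum>x\<in>UNIV - {0}. quad_char (f x))"
    by (rule sum.remove) auto
  finally show ?thesis by simp
qed

text \<open>Fourier inversion on the multiplicative group: Gauss sums are the Fourier coefficients
  of \<open>\<theta>\<close> on nonzero arguments.\<close>

lemma theta_expansion:
  assumes "u \<noteq> 0"
  shows "of_nat (q - 1) * \<theta> u = (\<Sum>k<q - 1. G (- int k) * tc (int k) u)"
proof -
  have "(\<Sum>k<q - 1. G (- int k) * tc (int k) u) = (\<Sum>k<q - 1. \<Sum>y\<in>UNIV. \<theta> y * tc (int k) (u / y))"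
    unfolding G_def gauss_def sum_distrib_right
    by (intro sum.cong refl) (simp add: tc_minus tc_divide inverse_eq_divide mult.commute)
  also have "\<dots> = (\<Sum>y\<in>UNIV. \<Sum>k<q - 1. \<theta> y * tc (int k) (u / y))"
    by (rule sum.swap)
  also have "\<dots> = (\<Sum>y\<in>UNIV. \<theta> y * (if u / y = 1 then of_nat (q - 1) else 0))"
    by (simp only: sum_distrib_left[symmetric] sum_tc_index)
  also have "\<dots> = (\<Sum>y\<in>UNIV. if y = u then \<theta> u * of_nat (q - 1) else 0)"
    using assms by (intro sum.cong refl) (auto simp: divide_eq_1_iff)
  finally show ?thesis by simp
qed

text \<open>Rewrites \<phi> additively, so that the terms of the polynomial separate. The case
  \<open>z = 0\<close> must be included because the polynomial may have roots.\<close>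

lemma quad_gauss:
  assumes h: "2 * h = n"
  shows "G h * tc h z = (\<Sum>w\<in>UNIV. tc h w * \<theta> (w * z))"
proof (cases "z = 0")
  case True
  have "0 < h" "h < n" using h q_ge_2 n_def by auto
  then have "\<not> n dvd h" using zdvd_imp_le[of n h] by auto
  then show ?thesis using True sum_tc_arg[of h] by simp
next
  case False
  have "tc (- h) = tc h" using h by (intro tc_cong) simp
  then show ?thesis
    using G_scale[OF False, of h] by (simp add: mult.commute)
qed

text \<open>As x^d + a x^(d-1) = x^(d-1) (x + a), absorbing x^(d-1) into \<open>w\<close> leaves
  \<open>\<theta> (a * w) * \<theta> (w * x)\<close>; the sum over \<open>x\<close> and then the sum
  over \<open>w\<close> are Gauss sums.\<close>

lemma inner_double_sum:
  assumes "a \<noteq> 0" "1 \<le> d"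
  shows "(\<Sum>x\<in>UNIV - {0}. \<Sum>w\<in>UNIV. tc m w * \<theta> (w * (x ^ d + a * x ^ (d - 1)))) =
    G (m * int d) * tc (- (m * int d)) a * G (- (m * (int d - 1)))"
proof -
  let ?e = "m * (int d - 1)"
  have e: "tc ?e x = tc m x ^ (d - 1)" if "x \<noteq> 0" for x
    using tc_times_nat[OF that, of m "d - 1"] assms(2) by (simp add: of_nat_diff)
  have "(\<Sum>x\<in>UNIV - {0}. \<Sum>w\<in>UNIV. tc m w * \<theta> (w * (x ^ d + a * x ^ (d - 1)))) =
    (\<Sum>x\<in>UNIV - {0}. \<Sum>w\<in>UNIV. tc m w * \<theta> (a * w) * (tc (- ?e) x * \<theta> (w * x)))"
  proof (rule sum.cong[OF refl])
    fix x :: 'a assume "x \<in> UNIV - {0}"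
    then have x: "x \<noteq> 0" by simp
    have xd: "x ^ d = x ^ (d - 1) * x" using assms(2) by (cases d) auto
    show "(\<Sum>w\<in>UNIV. tc m w * \<theta> (w * (x ^ d + a * x ^ (d - 1)))) =
      (\<Sum>w\<in>UNIV. tc m w * \<theta> (a * w) * (tc (- ?e) x * \<theta> (w * x)))"
    proof (rule sum.reindex_bij_witness[of _ "\<lambda>w. w / x ^ (d - 1)" "\<lambda>w. w * x ^ (d - 1)"])
      fix w :: 'a
      have "\<theta> (w * (x ^ d + a * x ^ (d - 1))) = \<theta> (a * (w * x ^ (d - 1))) * \<theta> (w * x ^ (d - 1) * x)"
        by (simp add: xd algebra_simps flip: add)
      moreover have "tc m (w * x ^ (d - 1)) * tc (- ?e) x = tc m w"
        using tc_nonzero[OF x, of m] by (simp add: tc_mult tc_power tc_minus e[OF x])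
      ultimately show "tc m (w * x ^ (d - 1)) * \<theta> (a * (w * x ^ (d - 1))) * (tc (- ?e) x * \<theta> (w * x ^ (d - 1) * x)) =
          tc m w * \<theta> (w * (x ^ d + a * x ^ (d - 1)))"
        by (simp add: mult_ac)
    qed (use x in auto)
  qed
  also have "\<dots> = (\<Sum>w\<in>UNIV. \<Sum>x\<in>UNIV - {0}. tc m w * \<theta> (a * w) * (tc (- ?e) x * \<theta> (w * x)))"
    by (rule sum.swap)
  also have "\<dots> = (\<Sum>w\<in>UNIV. tc (m * int d) w * \<theta> (a * w) * G (- ?e))"
  proof (rule sum.cong[OF refl])
    fix w :: 'a
    show "(\<Sum>x\<in>UNIV - {0}. tc m w * \<theta> (a * w) * (tc (- ?e) x * \<theta> (w * x))) =
        tc (m * int d) w * \<theta> (a * w) * G (- ?e)"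
    proof (cases "w = 0")
      case False
      have "(\<Sum>x\<in>UNIV - {0}. tc (- ?e) x * \<theta> (w * x)) = (\<Sum>x\<in>UNIV. tc (- ?e) x * \<theta> (w * x))"
        by (rule sum.mono_neutral_left) auto
      also have "\<dots> = G (- ?e) * tc ?e w"
        using G_scale[OF False, of "- ?e"] by simp
      finally have "(\<Sum>x\<in>UNIV - {0}. tc m w * \<theta> (a * w) * (tc (- ?e) x * \<theta> (w * x))) =
          tc m w * tc ?e w * \<theta> (a * w) * G (- ?e)"
        unfolding sum_distrib_left[symmetric] by (simp only: mult_ac)
      also have "tc m w * tc ?e w = tc (m * int d) w"
        by (simp add: algebra_simps flip: tc_add)
      finally show ?thesis .
    qed simp
  qed
  also have "\<dots> = G (m * int d) * tc (- (m * int d)) a * G (- ?e)"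
    using G_scale[OF assms(1), of "m * int d"] by (simp flip: sum_distrib_right)
  finally show ?thesis .
qed

text \<open>Only \<open>\<theta> (w * b)\<close> is expanded in characters: its argument is nonzero
  for \<open>w \<noteq> 0\<close>, and it twists \<open>tc h w\<close> into the form handled by
  \<open>inner_double_sum\<close>.\<close>

lemma quad_char_sum:
  assumes ab: "a \<noteq> 0" "b \<noteq> 0" and h: "2 * h = n" and d: "even d" "1 \<le> d"
  shows "of_nat (q - 1) * (G h * (\<Sum>x\<in>UNIV - {0}. tc h (x ^ d + a * x ^ (d - 1) + b))) =
    (\<Sum>k<q - 1. tc (int k) b * tc (- (int k * int d)) a * G (- int k) * G (int k * int d) * G (h - int k * (int d - 1)))"
proof -
  define f where "f x = x ^ d + a * x ^ (d - 1)" for x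
  have "of_nat (q - 1) * (G h * (\<Sum>x\<in>UNIV - {0}. tc h (x ^ d + a * x ^ (d - 1) + b))) =
      of_nat (q - 1) * (\<Sum>x\<in>UNIV - {0}. \<Sum>w\<in>UNIV. tc h w * \<theta> (w * (f x + b)))"
    by (simp add: sum_distrib_left quad_gauss[OF h] f_def)
  also have "\<dots> = (\<Sum>x\<in>UNIV - {0}. \<Sum>w\<in>UNIV. \<Sum>k<q - 1. G (- int k) * tc (int k) b * (tc (h + int k) w * \<theta> (w * f x)))"
    unfolding sum_distrib_left
  proof (intro sum.cong refl)
    fix x w :: 'a
    show "of_nat (q - 1) * (tc h w * \<theta> (w * (f x + b))) =
      (\<Sum>k<q - 1. G (- int k) * tc (int k) b * (tc (h + int k) w * \<theta> (w * f x)))"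
    proof (cases "w = 0")
      case False
      have "of_nat (q - 1) * (tc h w * \<theta> (w * (f x + b))) = tc h w * \<theta> (w * f x) * (of_nat (q - 1) * \<theta> (w * b))"
        by (simp add: distrib_left add mult_ac)
      also have "\<dots> = tc h w * \<theta> (w * f x) * (\<Sum>k<q - 1. G (- int k) * tc (int k) (w * b))"
        using False ab by (subst theta_expansion) auto
      also have "\<dots> = (\<Sum>k<q - 1. G (- int k) * tc (int k) b * (tc (h + int k) w * \<theta> (w * f x)))"
        by (simp add: sum_distrib_left tc_mult tc_add mult_ac)
      finally show ?thesis .
    qed simp
  qed
  also have "\<dots> = (\<Sum>x\<in>UNIV - {0}. \<Sum>k<q - 1. \<Sum>w\<in>UNIV. G (- int k) * tc (int k) b * (tc (h + int k) w * \<theta> (w * f x)))"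
    by (intro sum.cong refl sum.swap)
  also have "\<dots> = (\<Sum>k<q - 1. \<Sum>x\<in>UNIV - {0}. \<Sum>w\<in>UNIV. G (- int k) * tc (int k) b * (tc (h + int k) w * \<theta> (w * f x)))"
    by (rule sum.swap)
  also have "\<dots> = (\<Sum>k<q - 1. G (- int k) * tc (int k) b *
      (\<Sum>x\<in>UNIV - {0}. \<Sum>w\<in>UNIV. tc (h + int k) w * \<theta> (w * f x)))"
    by (simp only: sum_distrib_left)
  also have "\<dots> = (\<Sum>k<q - 1. tc (int k) b * tc (- (int k * int d)) a * G (- int k) * G (int k * int d) * G (h - int k * (int d - 1)))"
  proof (rule sum.cong[OF refl])
    fix k :: nat
    \<comment> \<open>Since \<open>d\<close> is even, \<open>h * d\<close> is a multiple of
      \<open>n\<close>: the shift by \<open>h\<close> disappears from the exponents with factor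
      \<open>d\<close> and becomes a single \<open>h\<close> in the one with factor
      \<open>d - 1\<close>.\<close>
    obtain e where e: "int d = 2 * e" using d(1) by (metis dvdE even_of_nat_iff)
    have 1: "n dvd (h + int k) * int d - int k * int d"
      unfolding e using h by (intro dvdI[of _ _ e]) (simp add: algebra_simps)
    have 2: "n dvd - ((h + int k) * int d) - - (int k * int d)"
      unfolding e using h by (intro dvdI[of _ _ "- e"]) (simp add: algebra_simps)
    have 3: "n dvd - ((h + int k) * (int d - 1)) - (h - int k * (int d - 1))"
      unfolding e using h by (intro dvdI[of _ _ "- e"]) (simp add: algebra_simps)
    show "G (- int k) * tc (int k) b * (\<Sum>x\<in>UNIV - {0}. \<Sum>w\<in>UNIV. tc (h + int k) w * \<theta> (w * f x)) =
      tc (int k) b * tc (- (int k * int d)) a * G (- int k) * G (int k * int d) * G (h - int k * (int d - 1))"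
      unfolding f_def inner_double_sum[OF ab(1) d(2)] G_cong[OF 1] G_cong[OF 3] tc_cong[OF 2]
      by (simp add: mult_ac)
  qed
  finally show ?thesis .
qed

end

subsection \<open>The hypergeometric side\<close>

context gauss_setup
begin

lemma G_pair:
  assumes "odd q" "n dvd u + v" "\<not> n dvd u" "even u"
  shows "G u * G v = of_nat q"
proof -
  have "G v = G (- u)" using assms(2) by (intro G_cong) (simp add: add.commute)
  then show ?thesis using G_times_G_minus[OF assms(3)] assms(1,4) by (simp add: tc_minus_1)
qed

lemma hasse_davenport_G:
  assumes "int m * \<bar>u\<bar> = n" "of_nat m \<noteq> (0 :: 'a)"
  shows "(\<Prod>i<m. G (u * int i + k)) = (\<Prod>i=1..<m. G (u * int i)) * G (k * int m) / tc k (of_nat m) ^ m"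
  using hasse_davenport[OF tc_mult_char exact_order_char_tc[OF assms(1)] assms(2), of k]
  by (simp add: char_pow_tc char_mult_tc G_def)

text \<open>The characteristic divides q, so it cannot divide a divisor of q - 1.\<close>

lemma of_nat_dvd_nonzero: "int m dvd n \<Longrightarrow> of_nat m \<noteq> (0 :: 'a)"
proof
  assume "int m dvd n" "of_nat m = (0 :: 'a)"
  then have "CHAR('a) dvd m" by (simp only: of_nat_eq_0_iff_char_dvd)
  moreover have "m dvd q - 1" using \<open>int m dvd n\<close> unfolding int_q_minus_1[symmetric] by simp
  ultimately have "CHAR('a) dvd q - 1" by (rule dvd_trans)
  moreover have "CHAR('a) dvd q" using CHAR_dvd_CARD[where 'a='a] by (simp add: q_def)
  ultimately have "CHAR('a) dvd 1"
    using q_ge_2 by (metis dvd_diff_nat diff_diff_cancel One_nat_def Suc_1 Suc_leD)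
  then show False using prime_CHAR_finite_field[where 'a='a] by simp
qed

section \<open>Gauss sum products for q - 1 = 2d(d-1)r, where \<chi>, \<psi>, \<phi> have exponents
  2(d-1)r, dr and h\<close>

context
  fixes d e :: nat and r h :: int
  assumes d: "d = 2 * e" "1 \<le> e"
    and n: "n = 2 * int d * (int d - 1) * r"
    and h: "h = int d * (int d - 1) * r"
begin

lemma two_h: "2 * h = n"
  by (simp add: n h)

lemma r_pos: "0 < r"
proof -
  have "0 < n" using q_ge_2 n_def by simp
  moreover have "0 < 2 * int d * (int d - 1)" using d by simp
  ultimately show ?thesis using n by (simp add: zero_less_mult_iff)
qed

lemma n_pos: "0 < n"
  using q_ge_2 n_def by simp

lemma odd_q: "odd q"
proof -
  have "even n" by (simp add: n)
  then show ?thesis by (simp add: n_def)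
qed

lemma even_h: "even h"
  by (simp add: h d)

lemma not_n_dvd: "v \<noteq> 0 \<Longrightarrow> \<bar>v\<bar> < n \<Longrightarrow> \<not> n dvd v"
  using dvd_imp_le_int[of v n] by auto

lemma not_n_dvd_r:
  assumes "v \<noteq> 0" "\<bar>v\<bar> < 2 * int d * (int d - 1)"
  shows "\<not> n dvd r * v"
  using assms r_pos unfolding n by (intro not_n_dvd[unfolded n]) (auto simp: abs_mult mult.commute)

lemma not_n_dvd_h: "\<not> n dvd h"
  using two_h n_pos by (intro not_n_dvd) auto

lemma G_h_square: "G h * G h = of_nat q"
  using odd_q not_n_dvd_h even_h two_h by (intro G_pair) auto

lemma G_minus_h: "G (- h) = G h"
  using two_h by (intro G_cong) simp

text \<open>Each \<chi>^i meets its inverse \<chi>^(d-i) and yields q; the fixed point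
  \<open>i = e\<close> is \<phi>.\<close>

lemma prod_G_chi: "(\<Prod>i=1..<d. G (2 * (int d - 1) * r * int i)) = G h * of_nat q ^ (e - 1)"
proof -
  let ?f = "\<lambda>i. G (2 * (int d - 1) * r * int i)"
  have "(\<Prod>i=1..<d. ?f i) = ?f e * (\<Prod>i\<in>{1..<d} - {e}. ?f i)"
    using d by (intro prod.remove) auto
  also have "?f e = G h" by (rule arg_cong[of _ _ G]) (simp add: h d)
  also have "(\<Prod>i\<in>{1..<d} - {e}. ?f i) = (\<Prod>j=1..<e. ?f j * ?f (2 * e - j))"
    unfolding d(1) by (rule prod_pair_even)
  also have "\<dots> = (\<Prod>j=1..<e. of_nat q)"
  proof (rule prod.cong[OF refl], rule G_pair[OF odd_q])
    fix j assume j: "j \<in> {1..<e}"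
    then have ij: "int (2 * e - j) = int d - int j" using d by auto
    show "n dvd 2 * (int d - 1) * r * int j + 2 * (int d - 1) * r * int (2 * e - j)"
      unfolding n ij by (intro dvdI[of _ _ 1]) (simp add: algebra_simps)
    define v where "v = 2 * (int d - 1) * int j"
    have "v < 2 * (int d - 1) * int d" "0 < v"
      using j d unfolding v_def by auto
    then have "v < 2 * int d * (int d - 1)" by (simp only: mult_ac)
    with \<open>0 < v\<close> have "\<not> n dvd r * v" by (intro not_n_dvd_r) auto
    then show "\<not> n dvd 2 * (int d - 1) * r * int j" by (simp add: v_def mult_ac)
  qed simp
  finally show ?thesis by simp
qed

text \<open>These are the nontrivial powers of the inverse of \<psi>^2, of odd order d - 1, so every
  one is paired with its inverse and no single Gauss sum remains.\<close>

lemma prod_G_psi: "(\<Prod>i=1..<d - 1. G (- (2 * int d * r) * int i)) = of_nat q ^ (e - 1)"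
proof -
  let ?f = "\<lambda>i. G (- (2 * int d * r) * int i)"
  have "(\<Prod>i=1..<d - 1. ?f i) = (\<Prod>j=1..<e. ?f j * ?f (2 * e - 1 - j))"
    unfolding d(1) by (rule prod_pair_odd)
  also have "\<dots> = (\<Prod>j=1..<e. of_nat q)"
  proof (rule prod.cong[OF refl], rule G_pair[OF odd_q])
    fix j assume j: "j \<in> {1..<e}"
    then have ij: "int (2 * e - 1 - j) = int d - 1 - int j" using d by auto
    show "n dvd - (2 * int d * r) * int j + - (2 * int d * r) * int (2 * e - 1 - j)"
      unfolding n ij by (intro dvdI[of _ _ "- 1"]) (simp add: algebra_simps)
    define v where "v = 2 * int d * int j"
    have "v < 2 * int d * (int d - 1)" "0 < v"
      using j d unfolding v_def by auto
    then have "\<not> n dvd r * v" by (intro not_n_dvd_r) auto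
    then show "\<not> n dvd - (2 * int d * r) * int j" by (simp add: v_def mult_ac)
  qed simp
  finally show ?thesis by simp
qed

text \<open>\<open>r * (d - 2 * j)\<close> is the exponent of \<chi>^j divided by \<psi>^(2j-1);
  this is the nondegeneracy of the j-th Jacobi sum, and it fails only at the index \<open>e\<close>
  removed from the rows.\<close>

lemma not_n_dvd_diff:
  assumes "j \<in> {1..<d} - {e}"
  shows "\<not> n dvd r * (int d - 2 * int j)"
proof (rule not_n_dvd_r)
  show "int d - 2 * int j \<noteq> 0" using assms d by auto
  have "\<bar>int d - 2 * int j\<bar> < int d" using assms by auto
  also have "int d \<le> int d * (2 * (int d - 1))" using d by simp
  finally show "\<bar>int d - 2 * int j\<bar> < 2 * int d * (int d - 1)" by (simp add: mult_ac)
qed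

text \<open>The exponents are antisymmetric under \<open>j \<mapsto> d - j\<close>, so the
  denominators of the Jacobi sums contribute a mere power of q.\<close>

lemma prod_G_denominators: "(\<Prod>j\<in>{1..<d} - {e}. G (r * (int d - 2 * int j))) = of_nat q ^ (e - 1)"
proof -
  let ?f = "\<lambda>j. G (r * (int d - 2 * int j))"
  have "(\<Prod>j\<in>{1..<d} - {e}. ?f j) = (\<Prod>j=1..<e. ?f j * ?f (2 * e - j))"
    unfolding d(1) by (rule prod_pair_even)
  also have "\<dots> = (\<Prod>j=1..<e. of_nat q)"
  proof (rule prod.cong[OF refl], rule G_pair[OF odd_q])
    fix j assume j: "j \<in> {1..<e}"
    then have ij: "int (2 * e - j) = int d - int j" using d by auto
    show "n dvd r * (int d - 2 * int j) + r * (int d - 2 * int (2 * e - j))"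
      unfolding ij by (simp add: algebra_simps)
    show "\<not> n dvd r * (int d - 2 * int j)" using j d by (intro not_n_dvd_diff) auto
  qed (simp add: d)
  finally show ?thesis by simp
qed

text \<open>The product formula for \<chi> runs over all \<open>i < d\<close>; its indices 0 and
  \<open>e\<close> are the Gauss sums from the upper parameters \<epsilon> and \<phi>.\<close>

lemma prod_G_top:
  "G k * G (h + k) * (\<Prod>j\<in>{1..<d} - {e}. G (2 * (int d - 1) * r * int j + k)) =
    G h * of_nat q ^ (e - 1) * G (k * int d) / tc k (of_nat d) ^ d"
proof -
  let ?u = "2 * (int d - 1) * r"
  let ?f = "\<lambda>i. G (?u * int i + k)"
  have u: "int d * \<bar>?u\<bar> = n" using r_pos d by (simp add: n abs_mult)
  have "int d dvd n" by (simp add: n)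
  from hasse_davenport_G[OF u of_nat_dvd_nonzero[OF this], of k]
  have "(\<Prod>i<d. ?f i) = G h * of_nat q ^ (e - 1) * G (k * int d) / tc k (of_nat d) ^ d"
    unfolding prod_G_chi .
  moreover have "(\<Prod>i<d. ?f i) = ?f 0 * (\<Prod>i\<in>{..<d} - {0}. ?f i)"
    using d by (intro prod.remove) auto
  moreover have "{..<d} - {0} = {1..<d}" by auto
  moreover have "(\<Prod>i=1..<d. ?f i) = ?f e * (\<Prod>i\<in>{1..<d} - {e}. ?f i)"
    using d by (intro prod.remove) auto
  moreover have "?f e = G (h + k)" by (rule arg_cong[of _ _ G]) (simp add: h d)
  ultimately show ?thesis by (simp add: mult.assoc)
qed

text \<open>Hasse--Davenport for \<open>d - 1\<close> is applied to the inverse of \<open>\<psi>\<^sup>2\<close>, so that its product over \<open>i\<close> runs through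
  the factors in the order \<open>j = i + 1\<close>.\<close>

lemma prod_G_bottom:
  "G (- (h + k)) * (\<Prod>j\<in>{1..<d} - {e}. G (- (int d * r * (2 * int j - 1) + k))) =
    of_nat q ^ (e - 1) * G (h - k * (int d - 1)) * tc h (of_nat (d - 1)) * tc k (of_nat (d - 1)) ^ (d - 1)"
proof -
  let ?u = "- (2 * int d * r)" and ?k = "- (int d * r) - k" and ?D = "of_nat (d - 1) :: 'a"
  let ?f = "\<lambda>j. G (- (int d * r * (2 * int j - 1) + k))"
  have d1: "int (d - 1) = int d - 1" using d by auto
  have u: "int (d - 1) * \<bar>?u\<bar> = n" unfolding d1 using r_pos by (simp add: n abs_mult)
  have "int (d - 1) dvd n" unfolding d1 by (simp add: n)
  then have D0: "?D \<noteq> 0" by (rule of_nat_dvd_nonzero)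
  have "(\<Prod>i<d - 1. G (?u * int i + ?k)) = of_nat q ^ (e - 1) * G (?k * (int d - 1)) / tc ?k ?D ^ (d - 1)"
    using hasse_davenport_G[OF u D0, of ?k] unfolding prod_G_psi d1 .
  also have "G (?k * (int d - 1)) = G (h - k * (int d - 1))"
    by (rule G_cong) (intro dvdI[of _ _ "- 1"], simp add: n h algebra_simps)
  also have "tc ?k ?D ^ (d - 1) = tc (- h) ?D * tc (- (k * (int d - 1))) ?D"
    using tc_times_nat[OF D0, of ?k "d - 1"] unfolding d1 tc_add[symmetric] by (simp add: h algebra_simps)
  also have "tc (- h) ?D = tc h ?D"
    using two_h by (simp add: tc_cong[of "- h" h])
  also have "tc (- (k * (int d - 1))) ?D = inverse (tc k ?D ^ (d - 1))"
    using tc_times_nat[OF D0, of k "d - 1"] unfolding d1 by (simp add: tc_minus)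
  finally have "(\<Prod>i<d - 1. G (?u * int i + ?k)) =
      of_nat q ^ (e - 1) * G (h - k * (int d - 1)) / (tc h ?D * inverse (tc k ?D ^ (d - 1)))" .
  moreover have "1 / tc h ?D = tc h ?D"
    using two_h tc_cong[of "- h" h] tc_minus[of h ?D] by (simp add: inverse_eq_divide)
  ultimately have "(\<Prod>i<d - 1. G (?u * int i + ?k)) =
      of_nat q ^ (e - 1) * G (h - k * (int d - 1)) * tc h ?D * tc k ?D ^ (d - 1)"
    by (metis (no_types, lifting) divide_inverse inverse_inverse_eq inverse_mult_distrib mult.assoc mult_1)
  moreover have "(\<Prod>i<d - 1. G (?u * int i + ?k)) = (\<Prod>j=1..<d. ?f j)"
    by (rule prod.reindex_bij_witness[of _ "\<lambda>j. j - 1" "\<lambda>i. i + 1"])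
       (auto simp: algebra_simps of_nat_diff intro!: arg_cong[of _ _ G])
  moreover have "(\<Prod>j=1..<d. ?f j) = ?f e * (\<Prod>j\<in>{1..<d} - {e}. ?f j)"
    using d by (intro prod.remove) auto
  moreover have "?f e = G (- (h + k))" by (rule arg_cong[of _ _ G]) (simp add: h d)
  ultimately show ?thesis by simp
qed

lemma tc_minus_1_add_even: "even v \<Longrightarrow> tc (v + k) (- 1) = tc k (- 1)"
  using odd_q by (simp add: tc_minus_1)

text \<open>Origin of \<open>e + 2\<close>: the d binomials put \<open>q ^ d\<close> in the
  denominator, the two \<open>G h\<close> add \<open>q\<close>, and the Jacobi denominators add
  \<open>q ^ (e - 1)\<close>; the top and bottom products each return \<open>q ^ (e - 1)\<close>.
  With \<open>d = 2 * e\<close> this leaves \<open>q ^ (e + 2)\<close> below.\<close>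

lemma hyp_term:
  assumes a: "a \<noteq> 0"
  shows "of_nat q ^ (e + 2) * (char_binom (tc (h + k)) (tc k) * (char_binom (tc k) (tc (h + k)) *
      (\<Prod>j\<in>{1..<d} - {e}. char_binom (tc (2 * (int d - 1) * r * int j + k)) (tc (int d * r * (2 * int j - 1) + k)))) *
      tc k (b * of_nat d ^ d / (a ^ d * of_nat (d - 1) ^ (d - 1)))) =
    G h * tc h (of_nat (d - 1)) *
      (tc k b * tc (- (k * int d)) a * G (- k) * G (k * int d) * G (h - k * (int d - 1)))"
proof -
  define Q where "Q = (of_nat q :: complex)"
  define \<sigma> where "\<sigma> = tc k (- 1)"
  let ?J = "{1..<d} - {e}"
  let ?x = "\<lambda>j. G (2 * (int d - 1) * r * int j + k)"
  let ?y = "\<lambda>j. G (- (int d * r * (2 * int j - 1) + k))"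
  let ?z = "\<lambda>j. G (r * (int d - 2 * int j))"
  have Q0: "Q \<noteq> 0" using q_ge_2 by (simp add: Q_def)
  \<comment> \<open>All lower exponents have the parity of \<open>k\<close>, so each of the d
    binomials carries the same sign \<sigma>, and d is even.\<close>
  have \<sigma>d: "\<sigma> ^ d = 1" using odd_q by (simp add: \<sigma>_def tc_minus_1 d)
  have b1: "char_binom (tc (h + k)) (tc k) = \<sigma> / Q * (G (h + k) * G (- k) / G h)"
    using char_binom_tc[of "h + k" k] not_n_dvd_h by (simp add: \<sigma>_def Q_def)
  have b2: "char_binom (tc k) (tc (h + k)) = \<sigma> / Q * (G k * G (- (h + k)) / G h)"
    using char_binom_tc[of k "h + k"] not_n_dvd_h tc_minus_1_add_even[OF even_h, of k] G_minus_h
    by (simp add: \<sigma>_def Q_def)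
  have bj: "char_binom (tc (2 * (int d - 1) * r * int j + k)) (tc (int d * r * (2 * int j - 1) + k)) =
      \<sigma> / Q * (?x j * ?y j / ?z j)" if "j \<in> ?J" for j
  proof -
    have diff: "2 * (int d - 1) * r * int j + k - (int d * r * (2 * int j - 1) + k) = r * (int d - 2 * int j)"
      by (simp add: algebra_simps)
    have "tc (int d * r * (2 * int j - 1) + k) (- 1) = \<sigma>"
      unfolding \<sigma>_def by (rule tc_minus_1_add_even) (simp add: d)
    then show ?thesis
      using char_binom_tc[of "2 * (int d - 1) * r * int j + k" "int d * r * (2 * int j - 1) + k"]
        not_n_dvd_diff[OF that] unfolding diff by (simp add: Q_def)
  qed
  define PX PY where "PX = prod ?x ?J" and "PY = prod ?y ?J"
  have cardJ: "card ?J = d - 2" using d by simp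
  have "(\<Prod>j\<in>?J. char_binom (tc (2 * (int d - 1) * r * int j + k)) (tc (int d * r * (2 * int j - 1) + k))) =
      (\<Prod>j\<in>?J. \<sigma> / Q * (?x j * ?y j / ?z j))"
    by (rule prod.cong[OF refl bj])
  also have "\<dots> = (\<Prod>j\<in>?J. \<sigma> / Q) * (\<Prod>j\<in>?J. ?x j * ?y j / ?z j)"
    by (rule prod.distrib)
  also have "(\<Prod>j\<in>?J. ?x j * ?y j / ?z j) = PX * PY / Q ^ (e - 1)"
    unfolding prod_dividef prod_G_denominators prod.distrib PX_def PY_def Q_def ..
  also have "(\<Prod>j\<in>?J. \<sigma> / Q) = (\<sigma> / Q) ^ (d - 2)"
    unfolding prod_constant cardJ ..
  finally have bJ: "(\<Prod>j\<in>?J. char_binom (tc (2 * (int d - 1) * r * int j + k)) (tc (int d * r * (2 * int j - 1) + k))) =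
      (\<sigma> / Q) ^ (d - 2) * (PX * PY / Q ^ (e - 1))" .
  define P where "P = (\<sigma> / Q * (G (h + k) * G (- k) / G h)) * ((\<sigma> / Q * (G k * G (- (h + k)) / G h)) *
      ((\<sigma> / Q) ^ (d - 2) * (PX * PY / Q ^ (e - 1))))"
  have top: "G k * G (h + k) * PX = G h * Q ^ (e - 1) * G (k * int d) / tc k (of_nat d) ^ d"
    unfolding PX_def Q_def by (rule prod_G_top)
  have bottom: "G (- (h + k)) * PY = Q ^ (e - 1) * G (h - k * (int d - 1)) * tc h (of_nat (d - 1)) * tc k (of_nat (d - 1)) ^ (d - 1)"
    unfolding PY_def Q_def by (rule prod_G_bottom)
  have "P = ((\<sigma> / Q) * (\<sigma> / Q) * (\<sigma> / Q) ^ (d - 2)) * (G k * G (h + k) * PX) * (G (- (h + k)) * PY) * G (- k) /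
      (G h * G h * Q ^ (e - 1))"
    by (simp add: P_def mult_ac)
  also have "(\<sigma> / Q) * (\<sigma> / Q) * (\<sigma> / Q) ^ (d - 2) = (\<sigma> / Q) ^ (Suc (Suc (d - 2)))"
    by simp
  also have "Suc (Suc (d - 2)) = d" using d by simp
  also have "(\<sigma> / Q) ^ d = 1 / (Q ^ (e - 1) * Q ^ (e - 1) * (Q * Q))"
  proof -
    have "d = (e - 1) + (e - 1) + 2" using d by simp
    then have "Q ^ d = Q ^ (e - 1) * Q ^ (e - 1) * (Q * Q)"
      by (metis power_add power2_eq_square)
    then show ?thesis unfolding power_divide \<sigma>d by simp
  qed
  also have "G h * G h = Q" unfolding Q_def by (rule G_h_square)
  finally have "P = 1 / (Q ^ (e - 1) * Q ^ (e - 1) * (Q * Q)) * (G k * G (h + k) * PX) * (G (- (h + k)) * PY) * G (- k) /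
      (Q * Q ^ (e - 1))" .
  moreover have Qe: "Q ^ (e + 2) = Q ^ (e - 1) * (Q * Q * Q)"
    using d(2) by (cases e) simp_all
  ultimately have P: "Q ^ (e + 2) * P = G h * tc h (of_nat (d - 1)) * G (- k) * G (k * int d) * G (h - k * (int d - 1)) *
      (tc k (of_nat (d - 1)) ^ (d - 1) / tc k (of_nat d) ^ d)"
    unfolding top bottom Qe using Q0 by simp
  have "int d dvd n" "int (d - 1) dvd n" using d by (auto simp: n of_nat_diff)
  then have nz: "tc k (of_nat d) \<noteq> 0" "tc k (of_nat (d - 1)) \<noteq> 0"
    by (auto intro!: tc_nonzero of_nat_dvd_nonzero)
  \<comment> \<open>The constants in \<beta> are chosen to cancel the values at \<open>d\<close> and
    \<open>d - 1\<close> left over by the two product formulas.\<close>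
  have \<beta>: "tc k (b * of_nat d ^ d / (a ^ d * of_nat (d - 1) ^ (d - 1))) =
      tc k b * tc (- (k * int d)) a * (tc k (of_nat d) ^ d / tc k (of_nat (d - 1)) ^ (d - 1))"
    unfolding tc_mult tc_divide tc_power tc_minus tc_times_nat[OF a] by (simp add: divide_inverse mult_ac)
  have "Q ^ (e + 2) * (P * tc k (b * of_nat d ^ d / (a ^ d * of_nat (d - 1) ^ (d - 1)))) =
      (Q ^ (e + 2) * P) * (tc k b * tc (- (k * int d)) a * (tc k (of_nat d) ^ d / tc k (of_nat (d - 1)) ^ (d - 1)))"
    unfolding \<beta> by (simp only: mult.assoc)
  also have "\<dots> = G h * tc h (of_nat (d - 1)) *
      (tc k b * tc (- (k * int d)) a * G (- k) * G (k * int d) * G (h - k * (int d - 1)))"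
    unfolding P using nz by simp
  finally show ?thesis
    unfolding b1 b2 bJ P_def Q_def .
qed

end

end

theorem theorem1p3:
  fixes T :: "'a::{field,finite} \<Rightarrow> complex"
    and p e d :: nat and a b :: 'a
  assumes "prime p" and "card (UNIV :: 'a set) = p ^ e"
    and "even d" and "d \<ge> 2"
    and "[card (UNIV :: 'a set) = 1] (mod (2 * d * (d - 1)))"
    and "a \<noteq> 0" and "b \<noteq> 0"
    and "char_generator T"
  shows
   "(let q = card (UNIV :: 'a set);
         \<chi> = char_pow T ((q - 1) div d);
         \<psi> = char_pow T ((q - 1) div (2 * (d - 1)));
         J = filter (\<lambda>j. j \<noteq> d div 2) [1..<d];
         As = [quad_char, triv_char] @ map (\<lambda>j. char_pow \<chi> j) J;
         Bs = quad_char # map (\<lambda>j. char_pow \<psi> (2 * j - 1)) J;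
         \<beta> = b * of_nat d ^ d / (a ^ d * of_nat (d - 1) ^ (d - 1))
     in of_nat (card {(x :: 'a, y). y ^ 2 = x ^ d + a * x ^ (d - 1) + b})
        = of_nat q + quad_char b
          + of_nat q ^ (d div 2) * quad_char (of_nat (d - 1) :: 'a) * gauss_hyp As Bs \<beta>)"
proof -
  define q where "q = card (UNIV :: 'a set)"
  define n where "n = int q - 1"
  have pp: "prime_power_card TYPE('a)" using assms(1,2) by (rule prime_power_cardI)
  obtain \<theta> :: "'a \<Rightarrow> complex" where \<theta>: "\<And>x y. \<theta> (x + y) = \<theta> x * \<theta> y" "\<theta> 0 = 1" "\<exists>c. \<theta> c \<noteq> 1"
    using additive_char_exists[OF pp] by blast
  interpret gauss_setup \<theta> T q n
    using pp \<theta> assms(8) by unfold_locales (auto simp: q_def n_def)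
  define m where "m = d div 2"
  have d: "d = 2 * m" "1 \<le> m" using assms(3,4) by (auto simp: m_def)
  have "2 * d * (d - 1) dvd q - 1"
    using assms(5) q_ge_2 unfolding q_def[symmetric] by (simp add: cong_sym_eq cong_altdef_nat)
  then obtain r' where r': "q - 1 = 2 * d * (d - 1) * r'" by blast
  define r h where "r = int r'" and "h = int d * (int d - 1) * r"
  have d1: "int (d - 1) = int d - 1" using assms(4) by (simp add: of_nat_diff)
  have n: "n = 2 * int d * (int d - 1) * r"
    unfolding int_q_minus_1[symmetric] r' by (simp only: of_nat_mult of_nat_numeral d1 r_def)
  note core = d n h_def
  define \<chi> \<psi> where "\<chi> = char_pow T ((q - 1) div d)" and "\<psi> = char_pow T ((q - 1) div (2 * (d - 1)))"
  define J where "J = filter (\<lambda>j. j \<noteq> d div 2) [1..<d]"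
  define As where "As = [quad_char, triv_char] @ map (\<lambda>j. char_pow \<chi> j) J"
  define Bs where "Bs = quad_char # map (\<lambda>j. char_pow \<psi> (2 * j - 1)) J"
  define \<beta> where "\<beta> = b * of_nat d ^ d / (a ^ d * of_nat (d - 1) ^ (d - 1))"
  define S where "S = (\<Sum>x\<in>UNIV - {0}. tc h (x ^ d + a * x ^ (d - 1) + b))"
  have phi: "quad_char = tc h" by (rule quad_char_tc[OF two_h[OF core]])
  have "(q - 1) div d = 2 * (d - 1) * r'"
    unfolding r' using assms(4) by simp
  then have \<chi>: "\<chi> = tc (2 * (int d - 1) * r)"
    unfolding \<chi>_def char_pow_T by (simp only: of_nat_mult of_nat_numeral d1 r_def)
  have "(q - 1) div (2 * (d - 1)) = (2 * (d - 1)) * (d * r') div (2 * (d - 1))"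
    unfolding r' by (simp only: mult_ac)
  also have "\<dots> = d * r'" using assms(4) by (subst nonzero_mult_div_cancel_left) auto
  finally have \<psi>: "\<psi> = tc (int d * r)"
    unfolding \<psi>_def char_pow_T by (simp add: r_def)
  have J: "set J = {1..<d} - {m}" "distinct J" by (auto simp: J_def m_def)
  define t where "t k = char_binom (tc (h + k)) (tc k) * (char_binom (tc k) (tc (h + k)) *
      (\<Prod>j\<in>{1..<d} - {m}. char_binom (tc (2 * (int d - 1) * r * int j + k)) (tc (int d * r * (2 * int j - 1) + k)))) *
      tc k \<beta>" for k
  have hyp_summand: "char_binom (char_mult (As ! 0) (tc k)) (tc k) *
      (\<Prod>i<length Bs. char_binom (char_mult (As ! Suc i) (tc k)) (char_mult (Bs ! i) (tc k))) * tc k \<beta> = t k" for k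
  proof -
    let ?g = "\<lambda>j. char_binom (tc (2 * (int d - 1) * r * int j + k)) (tc (int d * r * (2 * int j - 1) + k))"
    have "char_binom (char_mult (As ! Suc (Suc i)) (tc k)) (char_mult (Bs ! Suc i) (tc k)) = ?g (J ! i)"
      if i: "i < length J" for i
    proof -
      have "J ! i \<in> set J" using i by simp
      then have "1 \<le> J ! i" using J(1) by auto
      then have "int (2 * (J ! i) - 1) = 2 * int (J ! i) - 1" by simp
      then show ?thesis
        using i unfolding As_def Bs_def \<chi> \<psi> char_pow_tc by (simp add: char_mult_tc)
    qed
    then have "(\<Prod>i<length J. char_binom (char_mult (As ! Suc (Suc i)) (tc k)) (char_mult (Bs ! Suc i) (tc k))) =
        (\<Prod>i<length J. ?g (J ! i))"
      by (intro prod.cong) auto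
    also have "\<dots> = prod ?g (set J)"
      by (rule prod.reindex_bij_betw[OF bij_betw_nth[OF J(2) refl refl]])
    finally have rest: "(\<Prod>i<length J. char_binom (char_mult (As ! Suc (Suc i)) (tc k)) (char_mult (Bs ! Suc i) (tc k))) =
        prod ?g ({1..<d} - {m})"
      unfolding J(1) .
    have len: "length Bs = Suc (length J)" by (simp add: Bs_def)
    have 0: "char_mult (As ! 0) (tc k) = tc (h + k)" "char_mult (As ! Suc 0) (tc k) = tc k"
      "char_mult (Bs ! 0) (tc k) = tc (h + k)"
      by (simp_all add: As_def Bs_def phi triv_char_tc char_mult_tc)
    show ?thesis
      unfolding len prod.lessThan_Suc_shift rest 0 t_def ..
  qed
  have hyp: "gauss_hyp As Bs \<beta> = of_nat q / of_nat (q - 1) * (\<Sum>k<q - 1. t (int k))"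
    unfolding gauss_hyp_def sum_mult_chars hyp_summand using q_ge_2
    by (simp add: of_nat_diff flip: q_def)
  \<comment> \<open>The factor \<phi>(d - 1) is left by the product formula for
    \<open>d - 1\<close>; the one in front of the series cancels it because its square is 1.\<close>
  define \<delta> where "\<delta> = tc h (of_nat (d - 1))"
  have "int (d - 1) dvd n" unfolding d1 by (simp add: n)
  then have "of_nat (d - 1) \<noteq> (0 :: 'a)" by (rule of_nat_dvd_nonzero)
  then have \<delta>2: "\<delta> * \<delta> = 1"
    using two_h[OF core] tc_eq_triv_iff[of "h + h"] unfolding \<delta>_def tc_add[symmetric] by (simp add: tc_def)
  have "1 \<le> d" using assms(4) by simp
  note S_expansion = quad_char_sum[OF assms(6,7) two_h[OF core] assms(3) this, folded S_def]
  have "of_nat q ^ (m + 2) * (\<Sum>k<q - 1. t (int k)) = G h * \<delta> * (of_nat (q - 1) * (G h * S))"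
    unfolding S_expansion sum_distrib_left t_def \<beta>_def \<delta>_def
    by (intro sum.cong refl hyp_term[OF core assms(6)])
  also have "\<dots> = (G h * G h) * (\<delta> * of_nat (q - 1) * S)" by (simp only: mult_ac)
  also have "G h * G h = of_nat q" by (rule G_h_square[OF core])
  finally have sum: "of_nat q ^ (m + 2) * (\<Sum>k<q - 1. t (int k)) = of_nat q * (\<delta> * of_nat (q - 1) * S)" .
  have nz: "of_nat q \<noteq> (0 :: complex)" "of_nat (q - 1) \<noteq> (0 :: complex)" using q_ge_2 by auto
  \<comment> \<open>The extra \<open>q\<close> and the \<open>q\<close> in the normalisation of the
    series raise the exponent to \<open>m + 2\<close>, where the sum is known.\<close>
  have "of_nat q * (of_nat q ^ m * \<delta> * gauss_hyp As Bs \<beta>) =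
      \<delta> / of_nat (q - 1) * (of_nat q ^ (m + 2) * (\<Sum>k<q - 1. t (int k)))"
    unfolding hyp by (simp add: power_add power2_eq_square)
  also have "\<dots> = of_nat q * ((\<delta> * \<delta>) * S)"
    unfolding sum using nz by simp
  finally have "of_nat q ^ m * \<delta> * gauss_hyp As Bs \<beta> = S"
    unfolding \<delta>2 using nz by simp
  moreover have "of_nat (card {(x :: 'a, y). y ^ 2 = x ^ d + a * x ^ (d - 1) + b}) = of_nat q + quad_char b + S"
    using card_double_cover[OF odd_q[OF core], of "\<lambda>x. x ^ d + a * x ^ (d - 1) + b"] assms(4)
    by (simp add: phi S_def power_0_left)
  ultimately have "of_nat (card {(x :: 'a, y). y ^ 2 = x ^ d + a * x ^ (d - 1) + b}) =
      of_nat q + quad_char b + of_nat q ^ (d div 2) * quad_char (of_nat (d - 1) :: 'a) * gauss_hyp As Bs \<beta>"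
    by (simp add: phi \<delta>_def m_def)
  then show ?thesis
    unfolding Let_def As_def Bs_def J_def \<beta>_def \<chi>_def \<psi>_def q_def .
qed

end
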